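(* Let $t>1$ and let $B(0,R)$ denote the ball of radius $R$ centered at the origin in $\mathbb{R}^3$. The corresponding radial-hedgehog solution $\mathbf{Q}^*_R$ is stable against all small, smooth perturbations of the form $\mathbf{Q}=\mathbf{Q}^*_R+\epsilon\mathbf{P}$, where $\epsilon\in\mathbb{R}$, $|\epsilon|\ll1$, $\mathbf{P}$ is $\bar S$-valued and $\mathbf{P}=0$ on $\partial B(0,R)$, i.e. $$\left.\frac{d^2}{d\epsilon^2}\,\tilde{\mathcal I}_{LG}[\mathbf{Q}^*_R+\epsilon\mathbf{P}]\right|_{\epsilon=0}>0\quad\text{for every such smooth }\mathbf{P}\not\equiv0,$$ provided that the radius $R$ is sufficiently small, namely $$R^2<\frac14\left(\frac{1}{1+\frac{4\sqrt6\,h_+}{t}}\right).$$ In terms of the original (dimensional) variables, with $R=\sqrt t\,R_{real}/\xi$, this condition is equivalent to $$R_{real}^2<\frac{\xi^2}{4t}\left(\frac{1}{1+\frac{4\sqrt6\,h_+}{t}}\right).$$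
   Context: $h_+=\frac{3+\sqrt{9+8t}}{4}$, $B(0,R)=\{\mathbf{r}\in\mathbb{R}^3:|\mathbf{r}|\le R\}$, $\bar S$ is the space of symmetric, traceless real $3\times3$ matrices. The radial-hedgehog solution is $$\mathbf{Q}^*_R(\mathbf{r})=\sqrt{\tfrac32}\,h^*(r)\left(\frac{\mathbf{r}\otimes\mathbf{r}}{r^2}-\frac13\mathbf{I}\right),\quad r=|\mathbf{r}|,$$ where $h^*$ is a global minimizer, in $\mathcal{A}_h=\{h\in W^{1,2}([0,R],\mathbb{R}):h(R)=1\}$, of $$I[h]=\int_0^R r^2\left(\frac12\left(\frac{dh}{dr}\right)^2+\frac{3h^2}{r^2}+f(h)\right)dr,\qquad f(h)=-\frac{h^2}{2}-\frac{h_+}{t}h^3+\frac{h_+^2}{2t}h^4+C(t),$$ with $C(t)$ chosen so that $f\ge0$ and $f(1)=0$. The (dimensionless) Landau-de Gennes energy is $$\tilde{\mathcal I}_{LG}[\mathbf{Q}]=\int_{B(0,R)}\frac12|\nabla\mathbf{Q}|^2-\frac12\mathrm{tr}\,\mathbf{Q}^2-\frac{\sqrt6h_+}{t}\mathrm{tr}\,\mathbf{Q}^3+\frac{h_+^2}{2t}(\mathrm{tr}\,\mathbf{Q}^2)^2+C(t)\,dV,\qquad |\nabla\mathbf{Q}|^2=\sum_{i,j,k}\left(\frac{\partial \mathbf{Q}_{ij}}{\partial x_k}\right)^2 .$$ Here $t=\frac{27a^2c^2}{b^4}$ and $\xi=\sqrt{\frac{27c^2L}{b^4}}$ is the correlation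 length, where $a^2,b^2,c^2>0$ are the Landau-de Gennes bulk constants and $L>0$ is the elastic constant; lengths are rescaled so that a dimensional radius $R_{real}$ corresponds to the dimensionless radius $R=\sqrt t\,R_{real}/\xi$. Stability means positivity of the second variation of the energy. *)

theory Defs
  imports "HOL-Analysis.Analysis"
begin

section \<open>Bulk potential\<close>

definition h_plus :: "real \<Rightarrow> real" where
  "h_plus t = (3 + sqrt (9 + 8 * t)) / 4"

text \<open>The additive constant is the value determined by \<open>f 1 = 0\<close>; nonnegativity of \<open>f\<close> is
  \<open>bulk_f_nonneg\<close> below.\<close>

definition bulk_C :: "real \<Rightarrow> real" where
  "bulk_C t = 1 / 2 + h_plus t / t - (h_plus t)\<^sup>2 / (2 * t)"

definition bulk_f :: "real \<Rightarrow> real \<Rightarrow> real" where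
  "bulk_f t h = - h\<^sup>2 / 2 - h_plus t / t * h ^ 3 + (h_plus t)\<^sup>2 / (2 * t) * h ^ 4 + bulk_C t"

lemma bulk_f_one: "bulk_f t 1 = 0"
  by (simp add: bulk_f_def bulk_C_def)

lemma h_plus_root: "t > 0 \<Longrightarrow> 2 * (h_plus t)\<^sup>2 = 3 * h_plus t + t"
  by (simp add: h_plus_def power2_eq_square field_simps)

lemma bulk_f_nonneg:
  assumes "t > 0"
  shows "bulk_f t h \<ge> 0"
proof -
  define p where "p = h_plus t / t"
  have p: "p \<ge> 0"
    using assms by (simp add: p_def h_plus_def)
  have sq: "(h_plus t)\<^sup>2 / (2 * t) = 3 * p / 4 + 1 / 4"
    using h_plus_root[OF assms] assms by (simp add: p_def field_simps)
  have "bulk_f t h = (h - 1)\<^sup>2 * (p / 2 * h\<^sup>2 + (1 + p) / 4 * (h + 1)\<^sup>2)"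
    unfolding bulk_f_def bulk_C_def sq p_def[symmetric]
    by (simp add: power2_eq_square power3_eq_cube power4_eq_xxxx field_simps)
  then show ?thesis
    using p by simp
qed

section \<open>The radial minimization problem\<close>

definition L2_on :: "real set \<Rightarrow> (real \<Rightarrow> real) \<Rightarrow> bool" where
  "L2_on S g \<longleftrightarrow> g \<in> borel_measurable (lebesgue_on S) \<and> integrable (lebesgue_on S) (\<lambda>x. (g x)\<^sup>2)"

text \<open>Weak derivatives are tested against \<open>C\<^sub>c\<^sup>1(0,R)\<close>; \<open>\<phi>'\<close> is the derivative of \<open>\<phi>\<close>.\<close>

definition is_weak_deriv :: "real \<Rightarrow> (real \<Rightarrow> real) \<Rightarrow> (real \<Rightarrow> real) \<Rightarrow> bool" where
  "is_weak_deriv R h g \<longleftrightarrow>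
     (\<forall>\<phi> \<phi>' a b.
        (\<forall>x. (\<phi> has_real_derivative \<phi>' x) (at x)) \<and> continuous_on UNIV \<phi>' \<and>
        0 < a \<and> b < R \<and> (\<forall>x. x \<notin> {a..b} \<longrightarrow> \<phi> x = 0)
        \<longrightarrow> (LINT x|lebesgue_on {0..R}. h x * \<phi>' x) = - (LINT x|lebesgue_on {0..R}. g x * \<phi> x))"

text \<open>Elements of \<open>W\<^sup>1\<^sup>,\<^sup>2([0,R])\<close> are represented by their continuous representative, so that
  the boundary value \<open>h R\<close> is meaningful. Values outside \<open>[0,R]\<close> are irrelevant.\<close>

definition W12 :: "real \<Rightarrow> (real \<Rightarrow> real) set" where
  "W12 R = {h. continuous_on {0..R} h \<and> L2_on {0..R} h \<and>
               (\<exists>g. L2_on {0..R} g \<and> is_weak_deriv R h g)}"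

text \<open>The weak derivative is unique only almost everywhere; an arbitrary version is chosen.\<close>

definition weak_deriv :: "real \<Rightarrow> (real \<Rightarrow> real) \<Rightarrow> real \<Rightarrow> real" where
  "weak_deriv R h = (SOME g. L2_on {0..R} g \<and> is_weak_deriv R h g)"

definition admissible :: "real \<Rightarrow> (real \<Rightarrow> real) set" where
  "admissible R = {h \<in> W12 R. h R = 1}"

definition radial_energy :: "real \<Rightarrow> real \<Rightarrow> (real \<Rightarrow> real) \<Rightarrow> real" where
  "radial_energy t R h =
     (LINT r|lebesgue_on {0..R}.
        r\<^sup>2 * (1 / 2 * (weak_deriv R h r)\<^sup>2 + 3 * (h r)\<^sup>2 / r\<^sup>2 + bulk_f t (h r)))"

definition radial_minimizer :: "real \<Rightarrow> real \<Rightarrow> (real \<Rightarrow> real) \<Rightarrow> bool" where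
  "radial_minimizer t R h \<longleftrightarrow> is_arg_min (radial_energy t R) (\<lambda>k. k \<in> admissible R) h"

section \<open>Q-tensors and the Landau-de Gennes energy\<close>

definition sym_traceless :: "(real^3^3) set" where
  "sym_traceless = {A. transpose A = A \<and> trace A = 0}"

definition outer :: "real^3 \<Rightarrow> real^3 \<Rightarrow> real^3^3" where
  "outer x y = (\<chi> i j. x $ i * y $ j)"

text \<open>At the origin the quotient is \<open>0\<close> by convention; this single point does not affect the energy.\<close>

definition hedgehog :: "(real \<Rightarrow> real) \<Rightarrow> real^3 \<Rightarrow> real^3^3" where
  "hedgehog h x =
     (sqrt (3 / 2) * h (norm x)) *\<^sub>R ((1 / (norm x)\<^sup>2) *\<^sub>R outer x x - (1 / 3) *\<^sub>R mat 1)"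

definition partial_deriv :: "3 \<Rightarrow> (real^3 \<Rightarrow> real) \<Rightarrow> real^3 \<Rightarrow> real" where
  "partial_deriv k u x = deriv (\<lambda>s. u (x + s *\<^sub>R axis k 1)) 0"

definition grad_sq :: "(real^3 \<Rightarrow> real^3^3) \<Rightarrow> real^3 \<Rightarrow> real" where
  "grad_sq Q x = (\<Sum>i\<in>UNIV. \<Sum>j\<in>UNIV. \<Sum>k\<in>UNIV. (partial_deriv k (\<lambda>y. Q y $ i $ j) x)\<^sup>2)"

definition LG_energy :: "real \<Rightarrow> real \<Rightarrow> (real^3 \<Rightarrow> real^3^3) \<Rightarrow> real" where
  "LG_energy t R Q =
     (LINT x|lebesgue_on (cball 0 R).
        1 / 2 * grad_sq Q x
        - 1 / 2 * trace (Q x ** Q x)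
        - sqrt 6 * h_plus t / t * trace (Q x ** Q x ** Q x)
        + (h_plus t)\<^sup>2 / (2 * t) * (trace (Q x ** Q x))\<^sup>2
        + bulk_C t)"

section \<open>Perturbations and stability\<close>

fun C_k_on :: "nat \<Rightarrow> 'a::euclidean_space set \<Rightarrow> ('a \<Rightarrow> 'b::real_normed_vector) \<Rightarrow> bool" where
  "C_k_on 0 U f \<longleftrightarrow> continuous_on U f"
| "C_k_on (Suc k) U f \<longleftrightarrow>
     (\<forall>x\<in>U. f differentiable (at x)) \<and>
     (\<forall>v\<in>Basis. C_k_on k U (\<lambda>x. frechet_derivative f (at x) v))"

text \<open>Smoothness on the closed ball means smoothness up to the boundary, i.e. on some open
  neighbourhood of the ball.\<close>

definition perturbation :: "real \<Rightarrow> (real^3 \<Rightarrow> real^3^3) \<Rightarrow> bool" where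
  "perturbation R P \<longleftrightarrow>
     (\<exists>U. open U \<and> cball 0 R \<subseteq> U \<and> (\<forall>k. C_k_on k U P)) \<and>
     (\<forall>x\<in>cball 0 R. P x \<in> sym_traceless) \<and>
     (\<forall>x\<in>sphere 0 R. P x = 0)"

text \<open>The differentiability conjuncts say that the second variation exists, \<open>deriv\<close> being
  unspecified otherwise. Together with positivity they also force the energy density along the
  variation to be integrable when \<open>Q\<close> is differentiable almost everywhere: the density is
  then a polynomial in \<open>\<epsilon>\<close>, so otherwise the
  (totalized) integral would vanish for all but finitely many \<open>\<epsilon>\<close>.\<close>

definition second_variation_pos ::
  "real \<Rightarrow> real \<Rightarrow> (real^3 \<Rightarrow> real^3^3) \<Rightarrow> (real^3 \<Rightarrow> real^3^3) \<Rightarrow> bool" where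
  "second_variation_pos t R Q P \<longleftrightarrow>
     (let E = (\<lambda>\<epsilon>. LG_energy t R (\<lambda>x. Q x + \<epsilon> *\<^sub>R P x)) in
        (\<forall>\<^sub>F \<epsilon> in nhds 0. E field_differentiable (at \<epsilon>)) \<and>
        deriv E field_differentiable (at 0) \<and>
        deriv (deriv E) 0 > 0)"

definition LG_stable :: "real \<Rightarrow> real \<Rightarrow> (real^3 \<Rightarrow> real^3^3) \<Rightarrow> bool" where
  "LG_stable t R Q \<longleftrightarrow>
     (\<forall>P. perturbation R P \<and> (\<exists>x\<in>cball 0 R. P x \<noteq> 0) \<longrightarrow> second_variation_pos t R Q P)"

section \<open>Dimensional parameters\<close>

definition reduced_temperature :: "real \<Rightarrow> real \<Rightarrow> real \<Rightarrow> real" where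
  "reduced_temperature a b c = 27 * a\<^sup>2 * c\<^sup>2 / b ^ 4"

definition correlation_length :: "real \<Rightarrow> real \<Rightarrow> real \<Rightarrow> real" where
  "correlation_length b c L = sqrt (27 * c\<^sup>2 * L / b ^ 4)"

end

theory Submission imports Defs begin

text \<open>Minimality of \<open>h\<close> is needed only for regularity. Varying \<open>h\<close> by the primitive of
  \<open>r\<^sup>2 h' - W\<close>, where \<open>W r\<close> is the integral of \<open>6 h + s\<^sup>2 f'(h)\<close> over \<open>[0,r]\<close>, the first variation
  becomes the integral of \<open>(r\<^sup>2 h' - W)\<^sup>2\<close>. Hence \<open>h' = W / r\<^sup>2\<close>, so that \<open>h\<close> is \<open>C\<^sup>1\<close> on \<open>(0,R)\<close> with
  \<open>|h'| \<le> K / r\<close>; the gradient of the hedgehog is then \<open>O(1 / r)\<close> and square-integrable on the ball,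
  and the energy along a perturbation is a polynomial of degree four in \<open>\<epsilon>\<close>.

  In its quadratic coefficient the quartic bulk term absorbs the cubic one whatever the size of \<open>h\<close>:
  the potential part is at least \<open>- (1 + 27 / t) |P|\<^sup>2 / 2\<close>. On the other hand, integrating
  \<open>div (x\<^sub>k |P|\<^sup>2 e\<^sub>k)\<close> over the ball bounds the integral of \<open>|P|\<^sup>2\<close> by \<open>4 R\<^sup>2\<close> times that of
  \<open>|\<partial>\<^sub>k P|\<^sup>2\<close> for each of the three directions, and the radius condition gives
  \<open>4 R\<^sup>2 (1 + 27 / t) < 3\<close>.\<close>

section \<open>Square-integrable functions on an interval\<close>

text \<open>Two features of the encoding shape the proof. \<open>LG_energy\<close> uses pointwise
  partial derivatives and a totalized integral, so its second variation is out of reach until the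
  hedgehog is classically differentiable off a null set with square-integrable gradient.
  \<open>radial_energy\<close> contains an arbitrary version of the weak derivative, so
  almost-everywhere uniqueness must precede any comparison of radial energies.

  The variations of \<open>h\<close> are free at the origin. This natural boundary condition is why
  the relation between \<open>r\<^sup>2 * h'\<close> and \<open>W\<close> has no constant of
  integration, and hence why \<open>h'\<close> is not as singular as \<open>1 / r\<^sup>2\<close>.

  The number \<open>27 / t\<close> is the loss in completing the square: twice
  \<open>(3 / 2 * sqrt 6)\<^sup>2 / t\<close>. Using all three directions is essential: for
  \<open>t\<close> near \<open>1\<close> the quantity \<open>4 * sqrt 6 * h_plus t\<close> is about
  \<open>17.4\<close>, so the inequality for one direction would not absorb \<open>27\<close>,
  whereas three of them leave \<open>3 * 17.4\<close> to spare.\<close>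

lemma L2_on_integrable:
  fixes a b :: real
  assumes "L2_on {a..b} g"
  shows "integrable (lebesgue_on {a..b}) g"
proof (rule Bochner_Integration.integrable_bound[where f = "\<lambda>x. 1 + (g x)\<^sup>2"])
  show "integrable (lebesgue_on {a..b}) (\<lambda>x. 1 + (g x)\<^sup>2)"
    using assms by (auto simp: L2_on_def)
  have "\<bar>y\<bar> \<le> 1 + y\<^sup>2" for y :: real
    using zero_le_power2[of "\<bar>y\<bar> - 1"] zero_le_power2[of y]
    unfolding power2_diff power2_abs one_power2 by linarith
  then show "AE x in lebesgue_on {a..b}. norm (g x) \<le> norm (1 + (g x)\<^sup>2)"
    by (auto simp: add_nonneg_nonneg)
qed (use assms in \<open>auto simp: L2_on_def\<close>)

lemma L2_on_mult:
  assumes "L2_on S f" "L2_on S g"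
  shows "integrable (lebesgue_on S) (\<lambda>x. f x * g x)"
proof (rule Bochner_Integration.integrable_bound[where f = "\<lambda>x. (f x)\<^sup>2 + (g x)\<^sup>2"])
  have "\<bar>x * y\<bar> \<le> x\<^sup>2 + y\<^sup>2" for x y :: real
    using sum_squares_bound[of "\<bar>x\<bar>" "\<bar>y\<bar>"] mult_nonneg_nonneg[of "\<bar>x\<bar>" "\<bar>y\<bar>"]
    unfolding abs_mult power2_abs by linarith
  then show "AE x in lebesgue_on S. norm (f x * g x) \<le> norm ((f x)\<^sup>2 + (g x)\<^sup>2)"
    by auto
qed (use assms in \<open>auto simp: L2_on_def\<close>)

lemma L2_on_add:
  assumes "L2_on S f" "L2_on S g"
  shows "L2_on S (\<lambda>x. f x + c * g x)"
proof -
  have "integrable (lebesgue_on S) (\<lambda>x. (f x)\<^sup>2 + 2 * c * (f x * g x) + c\<^sup>2 * (g x)\<^sup>2)"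
    using assms L2_on_mult[OF assms] by (auto simp: L2_on_def)
  also have "(\<lambda>x. (f x)\<^sup>2 + 2 * c * (f x * g x) + c\<^sup>2 * (g x)\<^sup>2) = (\<lambda>x. (f x + c * g x)\<^sup>2)"
    by (auto simp: power2_eq_square algebra_simps)
  finally show ?thesis
    using assms by (auto simp: L2_on_def)
qed

lemma continuous_L2_on:
  assumes "continuous_on {a..b} f"
  shows "L2_on {a..b} f"
  using assms
  by (auto simp: L2_on_def intro!: continuous_imp_integrable_real continuous_intros
      continuous_imp_measurable_on_sets_lebesgue)

lemma L2_on_continuous_mult:
  assumes "continuous_on {a..b} f" "L2_on {a..b} g"
  shows "L2_on {a..b} (\<lambda>x. f x * g x)"
proof -
  have f: "f \<in> borel_measurable (lebesgue_on {a..b})"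
    using assms by (intro continuous_imp_measurable_on_sets_lebesgue) auto
  have "bounded (f ` {a..b})"
    using assms by (intro compact_imp_bounded compact_continuous_image) auto
  then obtain B where "\<forall>y\<in>f ` {a..b}. norm y \<le> B"
    unfolding bounded_iff by blast
  then have B: "\<bar>f x\<bar> \<le> B" if "x \<in> {a..b}" for x
    using that by simp
  have "integrable (lebesgue_on {a..b}) (\<lambda>x. (f x * g x)\<^sup>2)"
  proof (rule Bochner_Integration.integrable_bound[where f = "\<lambda>x. B\<^sup>2 * (g x)\<^sup>2"])
    show "AE x in lebesgue_on {a..b}. norm ((f x * g x)\<^sup>2) \<le> norm (B\<^sup>2 * (g x)\<^sup>2)"
      using power_mono[OF B, of _ 2] by (intro AE_I2) (auto simp: power_mult_distrib intro!: mult_right_mono)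
  qed (use assms f in \<open>auto simp: L2_on_def\<close>)
  then show ?thesis
    using assms f by (auto simp: L2_on_def)
qed

lemma AE_lebesgue_on_negligible:
  assumes "negligible N" "S \<in> sets lebesgue" "\<And>x. x \<in> S \<Longrightarrow> x \<notin> N \<Longrightarrow> P x"
  shows "AE x in lebesgue_on S. P x"
proof -
  have "AE x in lebesgue. x \<in> S \<longrightarrow> P x"
    using assms by (intro AE_I'[of N]) (auto simp: negligible_iff_null_sets)
  then show ?thesis
    using assms by (simp add: AE_restrict_space_iff)
qed

text \<open>Energies and weak derivatives are Bochner integrals over \<open>lebesgue_on\<close>,
  while primitives are written as gauge integrals over subintervals; this passes from one to the
  other.\<close>

lemma LINT_indicator_subinterval:
  fixes u :: "real \<Rightarrow> real"
  assumes "integrable (lebesgue_on {a..b}) u" "{c..d} \<subseteq> {a..b}"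
  shows "(LINT s|lebesgue_on {a..b}. indicator {c..d} s * u s) = integral {c..d} u"
    and "u integrable_on {c..d}"
proof -
  have "integrable (lebesgue_on {a..b}) (\<lambda>s. indicator {c..d} s *\<^sub>R u s)"
    by (rule integrable_mult_indicator[OF _ assms(1)]) (use assms(2) in \<open>auto simp: sets_restrict_space_iff\<close>)
  then have "(LINT s|lebesgue_on {a..b}. indicator {c..d} s * u s) = integral {a..b} (\<lambda>s. indicator {c..d} s * u s)"
    by (intro lebesgue_integral_eq_integral) auto
  also have "\<dots> = integral {a..b} (\<lambda>s. if s \<in> {c..d} then u s else 0)"
    by (intro arg_cong[where f="integral _"]) (auto simp: indicator_def)
  also have "\<dots> = integral {c..d} u"
    using assms(2) by (simp only: Henstock_Kurzweil_Integration.integral_restrict_Int Int_absorb2)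
  finally show "(LINT s|lebesgue_on {a..b}. indicator {c..d} s * u s) = integral {c..d} u" .
  have "u integrable_on {a..b}"
    using assms(1) by (simp add: integrable_on_lebesgue_on)
  then show "u integrable_on {c..d}"
    using assms(2) integrable_on_subinterval by blast
qed

text \<open>Fubini on the triangle \<open>x \<le> s\<close>. It replaces integration by parts when a
  factor is only the primitive of an integrable function, both for weak derivatives of primitives
  and for the Euler-Lagrange equation.\<close>

lemma integral_swap_triangle:
  fixes \<theta> w :: "real \<Rightarrow> real"
  assumes "integrable (lebesgue_on {a..b}) \<theta>" "integrable (lebesgue_on {a..b}) w"
  shows "(LINT x|lebesgue_on {a..b}. w x * integral {x..b} \<theta>) =
    (LINT s|lebesgue_on {a..b}. \<theta> s * integral {a..s} w)"
proof -
  let ?M = "lebesgue_on {a..b}"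
  interpret M: finite_measure ?M by (metis cbox_interval finite_measure_lebesgue_on lmeasurable_cbox)
  interpret pair_sigma_finite ?M ?M ..
  have [measurable]: "\<theta> \<in> borel_measurable ?M" "w \<in> borel_measurable ?M"
    using assms by auto
  have [measurable]: "(\<lambda>x. x) \<in> borel_measurable ?M"
    using id_borel_measurable_lebesgue_on by (simp add: id_def)
  let ?F = "\<lambda>x s. if x \<le> s then w x * \<theta> s else 0"
  have F: "integrable (?M \<Otimes>\<^sub>M ?M) (case_prod ?F)"
  proof (rule Bochner_Integration.integrable_bound[where f = "\<lambda>(x, s). w x * \<theta> s"])
    show "integrable (?M \<Otimes>\<^sub>M ?M) (\<lambda>(x, s). w x * \<theta> s)"
    proof (rule Fubini_integrable)
      show "integrable ?M (\<lambda>x. LINT y|?M. norm (case (x, y) of (x, s) \<Rightarrow> w x * \<theta> s))"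
        using assms by (simp add: abs_mult)
      show "AE x in ?M. integrable ?M (\<lambda>y. case (x, y) of (x, s) \<Rightarrow> w x * \<theta> s)"
        using assms by auto
    qed measurable
  qed (auto simp: split_beta)
  have "(LINT x|?M. w x * integral {x..b} \<theta>) = (LINT x|?M. LINT s|?M. ?F x s)"
  proof (rule Bochner_Integration.integral_cong[OF refl])
    fix x assume x: "x \<in> space ?M"
    then have "w x * integral {x..b} \<theta> = (LINT s|?M. w x * (indicator {x..b} s * \<theta> s))"
      by (subst LINT_indicator_subinterval(1)[OF assms(1), symmetric]) auto
    also have "\<dots> = (LINT s|?M. ?F x s)"
      by (intro Bochner_Integration.integral_cong) (auto simp: indicator_def)
    finally show "w x * integral {x..b} \<theta> = (LINT s|?M. ?F x s)" .
  qed
  also have "\<dots> = (LINT s|?M. LINT x|?M. ?F x s)"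
    using Fubini_integral[OF F] by simp
  also have "\<dots> = (LINT s|?M. \<theta> s * integral {a..s} w)"
  proof (rule Bochner_Integration.integral_cong[OF refl])
    fix s assume s: "s \<in> space ?M"
    then have "\<theta> s * integral {a..s} w = (LINT x|?M. \<theta> s * (indicator {a..s} x * w x))"
      by (subst LINT_indicator_subinterval(1)[OF assms(2), symmetric]) auto
    also have "\<dots> = (LINT x|?M. ?F x s)"
      by (intro Bochner_Integration.integral_cong) (auto simp: indicator_def)
    finally show "(LINT x|?M. ?F x s) = \<theta> s * integral {a..s} w" by simp
  qed
  finally show ?thesis .
qed

text \<open>Lebesgue differentiation: almost every value \<open>u x\<close> is a limit of means over
  intervals to the right of \<open>x\<close>, and each such mean is a difference of two vanishing
  tail integrals.\<close>

lemma integral_zero_imp_AE_zero: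
  fixes u :: "real \<Rightarrow> real"
  assumes "integrable (lebesgue_on {a..b}) u" "\<And>x. x \<in> {a..b} \<Longrightarrow> integral {x..b} u = 0"
  shows "AE x in lebesgue_on {a..b}. u x = 0"
proof -
  \<comment> \<open>The differentiation theorem is applied to a function integrable on every
    interval, hence the extension by zero.\<close>
  define v where "v = (\<lambda>x. if x \<in> {a..b} then u x else 0)"
  have "u integrable_on {a..b}"
    using assms(1) by (simp add: integrable_on_lebesgue_on)
  then have "v integrable_on UNIV"
    unfolding v_def by (subst integrable_restrict_UNIV)
  then have v: "v integrable_on cbox c d" for c d
    using integrable_on_subcbox by blast
  obtain N where N: "negligible N" "\<And>x e. \<lbrakk>x \<notin> N; 0 < e\<rbrakk> \<Longrightarrow> \<exists>d>0. \<forall>h. 0 < h \<and> h < d \<longrightarrow>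
       norm (integral (cbox x (x + h *\<^sub>R One)) v /\<^sub>R h ^ DIM(real) - v x) < e"
    by (rule integrable_ccontinuous_explicit[of v]) (use v in auto)
  show ?thesis
  proof (rule AE_lebesgue_on_negligible)
    \<comment> \<open>\<open>b\<close> joins the exceptional set because the means are taken to the
      right and must stay inside \<open>{a..b}\<close>.\<close>
    show "negligible (N \<union> {b})" using N by auto
    fix x assume x: "x \<in> {a..b}" "x \<notin> N \<union> {b}"
    show "u x = 0"
    proof (rule ccontr)
      assume "u x \<noteq> 0"
      then obtain d where d: "d > 0" "\<And>h. 0 < h \<Longrightarrow> h < d \<Longrightarrow> norm (integral {x..x + h} v / h - v x) < \<bar>u x\<bar>"
        using N(2)[of x "\<bar>u x\<bar>"] x by (auto simp: divide_inverse_commute)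
      define h where "h = min (d / 2) (b - x)"
      have h: "0 < h" "h < d" "x + h \<le> b" using d x by (auto simp: h_def)
      have "integral {x..x + h} v = integral {x..x + h} u"
        using x h by (intro integral_cong) (auto simp: v_def)
      also have "\<dots> = 0"
      proof -
        have "u integrable_on {x..b}"
          by (rule LINT_indicator_subinterval(2)[OF assms(1)]) (use x in auto)
        then have "integral {x..x + h} u + integral {x + h..b} u = integral {x..b} u"
          using x h by (intro Henstock_Kurzweil_Integration.integral_combine) auto
        with assms(2)[of x] assms(2)[of "x + h"] x h show ?thesis by auto
      qed
      finally show False using d(2)[OF h(1,2)] x by (auto simp: v_def)
    qed
  qed auto
qed

section \<open>Weak derivatives and primitives\<close>

lemma compactly_supported_primitive:
  fixes \<eta> :: "real \<Rightarrow> real"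
  assumes "0 < a" "\<And>x. (\<phi> has_real_derivative \<eta> x) (at x)" "\<And>x. x \<notin> {a..b} \<Longrightarrow> \<phi> x = 0" "s \<ge> 0"
  shows "integral {0..s} \<eta> = \<phi> s"
proof -
  have "(\<eta> has_integral (\<phi> s - \<phi> 0)) {0..s}"
    using assms by (intro fundamental_theorem_of_calculus)
      (auto simp: has_real_derivative_iff_has_vector_derivative intro: has_vector_derivative_at_within)
  then show ?thesis using assms(1,3) by (auto simp: integral_unique)
qed

text \<open>Fubini moves the tail integral of \<open>\<theta>\<close> onto \<open>\<phi>'\<close>,
  whose integral from \<open>0\<close> is \<open>\<phi>\<close> because the support starts at
  \<open>a > 0\<close>. Normalising the primitive at \<open>R\<close> lets it serve as a variation
  that keeps the boundary value.\<close>

lemma is_weak_deriv_primitive: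
  assumes "L2_on {0..R} \<theta>"
  shows "is_weak_deriv R (\<lambda>x. - integral {x..R} \<theta>) \<theta>"
  unfolding is_weak_deriv_def
proof (intro allI impI, elim conjE)
  fix \<phi> \<phi>' :: "real \<Rightarrow> real" and a b
  assume \<phi>: "\<forall>x. (\<phi> has_real_derivative \<phi>' x) (at x)" "continuous_on UNIV \<phi>'" "0 < a" "b < R"
    "\<forall>x. x \<notin> {a..b} \<longrightarrow> \<phi> x = 0"
  have "integrable (lebesgue_on {0..R}) \<phi>'"
    using \<phi> by (intro continuous_imp_integrable_real) (auto intro: continuous_on_subset)
  then have "(LINT x|lebesgue_on {0..R}. \<phi>' x * integral {x..R} \<theta>) =
      (LINT s|lebesgue_on {0..R}. \<theta> s * integral {0..s} \<phi>')"
    by (rule integral_swap_triangle[OF L2_on_integrable[OF assms]])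
  also have "\<dots> = (LINT s|lebesgue_on {0..R}. \<theta> s * \<phi> s)"
    using \<phi> by (intro Bochner_Integration.integral_cong) (auto intro!: compactly_supported_primitive)
  finally show "(LINT x|lebesgue_on {0..R}. - integral {x..R} \<theta> * \<phi>' x) = - (LINT x|lebesgue_on {0..R}. \<theta> x * \<phi> x)"
    by (simp add: mult.commute)
qed

lemma continuous_on_primitive:
  assumes "L2_on {0..R} \<theta>"
  shows "continuous_on {0..R} (\<lambda>x. - integral {x..R} \<theta>)"
  using L2_on_integrable[OF assms]
  by (intro continuous_intros indefinite_integral_continuous_1') (simp add: integrable_on_lebesgue_on)

lemma is_weak_deriv_add:
  assumes "is_weak_deriv R h g" "is_weak_deriv R k \<theta>"
    and "continuous_on {0..R} h" "continuous_on {0..R} k" "L2_on {0..R} g" "L2_on {0..R} \<theta>"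
  shows "is_weak_deriv R (\<lambda>x. h x + c * k x) (\<lambda>x. g x + c * \<theta> x)"
  unfolding is_weak_deriv_def
proof (intro allI impI)
  fix \<phi> \<phi>' :: "real \<Rightarrow> real" and a b
  assume \<phi>: "(\<forall>x. (\<phi> has_real_derivative \<phi>' x) (at x)) \<and> continuous_on UNIV \<phi>' \<and> 0 < a \<and> b < R \<and>
    (\<forall>x. x \<notin> {a..b} \<longrightarrow> \<phi> x = 0)"
  have "continuous_on UNIV \<phi>"
    using \<phi> by (intro DERIV_continuous_on) (auto intro: has_field_derivative_at_within)
  then have L: "L2_on {0..R} \<phi>" "L2_on {0..R} \<phi>'"
    using \<phi> continuous_on_subset[OF _ subset_UNIV] by (blast intro: continuous_L2_on)+
  note I = L2_on_mult[OF continuous_L2_on[OF assms(3)] L(2)] L2_on_mult[OF continuous_L2_on[OF assms(4)] L(2)]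
    L2_on_mult[OF assms(5) L(1)] L2_on_mult[OF assms(6) L(1)]
  have *: "(LINT x|lebesgue_on {0..R}. h x * \<phi>' x) = - (LINT x|lebesgue_on {0..R}. g x * \<phi> x)"
    "(LINT x|lebesgue_on {0..R}. k x * \<phi>' x) = - (LINT x|lebesgue_on {0..R}. \<theta> x * \<phi> x)"
    using assms(1,2) \<phi> unfolding is_weak_deriv_def by blast+
  have "(LINT x|lebesgue_on {0..R}. (h x + c * k x) * \<phi>' x) =
      (LINT x|lebesgue_on {0..R}. h x * \<phi>' x + c * (k x * \<phi>' x))"
    by (simp add: algebra_simps)
  also have "\<dots> = - ((LINT x|lebesgue_on {0..R}. g x * \<phi> x) + c * (LINT x|lebesgue_on {0..R}. \<theta> x * \<phi> x))"
    using I by (simp add: *)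
  also have "\<dots> = - (LINT x|lebesgue_on {0..R}. g x * \<phi> x + c * (\<theta> x * \<phi> x))"
    using I by simp
  finally show "(LINT x|lebesgue_on {0..R}. (h x + c * k x) * \<phi>' x) =
      - (LINT x|lebesgue_on {0..R}. (g x + c * \<theta> x) * \<phi> x)"
    by (simp add: algebra_simps)
qed

text \<open>The test function has derivative \<open>(d - m) \<eta>\<close>, where \<open>\<eta>\<close> is a bump on \<open>(a,b)\<close> and \<open>m\<close> the
  \<open>\<eta>\<close>-weighted mean of \<open>d\<close>; testing with it yields \<open>\<integral> (d - m)\<^sup>2 \<eta> = 0\<close>.\<close>

lemma du_Bois_Reymond_interval:
  assumes d: "continuous_on {0..R} d" and wd: "is_weak_deriv R d (\<lambda>_. 0)"
    and ab: "0 < a" "a < b" "b < R"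
  shows "\<exists>m. \<forall>x\<in>{a<..<b}. d x = m"
proof -
  \<comment> \<open>Clamping the argument to \<open>{a..b}\<close> makes \<open>d\<close> continuous
    on the whole line, so that \<open>p\<close> below has a global antiderivative.\<close>
  define e where "e = (\<lambda>x. d (min b (max a x)))"
  have e: "continuous_on UNIV e" unfolding e_def
    by (rule continuous_on_compose2[OF d]) (use ab in \<open>auto intro!: continuous_intros\<close>)
  \<comment> \<open>A merely continuous bump suffices, since it enters the derivative of a test
    function that only has to be continuously differentiable.\<close>
  define \<eta> where "\<eta> = (\<lambda>x. max 0 ((x - a) * (b - x)))"
  have \<eta>: "continuous_on UNIV \<eta>" unfolding \<eta>_def by (intro continuous_intros)
  have \<eta>0: "\<eta> x = 0" if "x \<notin> {a<..<b}" for x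
    using that ab by (auto simp: \<eta>_def mult_nonneg_nonpos mult_nonpos_nonneg intro!: max_absorb1)
  have \<eta>pos: "\<eta> x > 0" if "x \<in> {a<..<b}" for x
    using that by (auto simp: \<eta>_def less_max_iff_disj)
  have \<eta>nn: "\<eta> x \<ge> 0" for x by (simp add: \<eta>_def)
  have int: "f integrable_on {c..d}" if "continuous_on UNIV f" for f :: "real \<Rightarrow> real" and c d
    using that by (intro integrable_continuous_real) (auto intro: continuous_on_subset)
  have zero: "f x = 0" if "continuous_on UNIV f" "\<And>x. f x \<ge> 0" "integral {a..b} f = 0" "x \<in> {a..b}" for f :: "real \<Rightarrow> real" and x
  proof -
    have "(f has_integral 0) (cbox a b)"
      using int[OF that(1), of a b] that(3) by (metis has_integral_integral interval_cbox)
    then show ?thesis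
      using has_integral_0_cbox_imp_0[of a b f x] that ab by (auto intro: continuous_on_subset)
  qed
  have I\<eta>: "integral {a..b} \<eta> \<noteq> 0"
    using zero[OF \<eta> \<eta>nn, of "(a+b)/2"] \<eta>pos[of "(a+b)/2"] ab by auto
  \<comment> \<open>With this value the integral of \<open>p\<close> over \<open>{a..b}\<close>
    vanishes, which lets its primitive return to zero at \<open>b\<close> and so have compact
    support.\<close>
  define m where "m = integral {a..b} (\<lambda>x. e x * \<eta> x) / integral {a..b} \<eta>"
  define p where "p = (\<lambda>x. (e x - m) * \<eta> x)"
  have p: "continuous_on UNIV p" unfolding p_def by (intro continuous_intros e \<eta>)
  have p0: "p x = 0" if "x \<notin> {a<..<b}" for x using \<eta>0[OF that] by (simp add: p_def)
  have Ip: "integral {a..b} p = 0"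
  proof -
    have "integral {a..b} p = integral {a..b} (\<lambda>x. e x * \<eta> x) - integral {a..b} (\<lambda>x. m * \<eta> x)"
      unfolding p_def by (subst integral_diff[symmetric])
        (auto simp: algebra_simps intro!: int continuous_intros e \<eta>)
    then show ?thesis using I\<eta> by (simp add: m_def)
  qed
  obtain F where F: "\<And>x. (F has_real_derivative p x) (at x)"
    using einterval_antiderivative[of "-\<infinity>" "\<infinity>" p] p
    by (auto simp: continuous_on_eq_continuous_at has_real_derivative_iff_has_vector_derivative)
  have FI: "integral {u..v} p = F v - F u" if "u \<le> v" for u v
    using that by (intro integral_unique fundamental_theorem_of_calculus)
      (auto simp: has_real_derivative_iff_has_vector_derivative[symmetric] intro: has_field_derivative_at_within F)
  have vanish: "integral {u..v} p = 0" if "{u..v} \<inter> {a<..<b} = {}" for u v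
  proof -
    have "integral {u..v} p = integral {u..v} (\<lambda>_. 0)"
      using that by (intro integral_cong p0) auto
    then show ?thesis by simp
  qed
  define \<phi> where "\<phi> = (\<lambda>x. F x - F a)"
  have \<phi>: "(\<phi> has_real_derivative p x) (at x)" for x
    unfolding \<phi>_def by (auto intro!: derivative_eq_intros F)
  have \<phi>0: "\<phi> x = 0" if "x \<notin> {a..b}" for x
  proof (cases "x < a")
    case True
    then have "F x = F a" using FI[of x a] vanish[of x a] by fastforce
    then show ?thesis by (simp add: \<phi>_def)
  next
    case False
    then have "b \<le> x" using that by auto
    then have "F x = F b" "F b = F a" using FI[of b x] FI[of a b] vanish[of b x] Ip ab by fastforce+
    then show ?thesis by (simp add: \<phi>_def)
  qed
  have "(LINT x|lebesgue_on {0..R}. d x * p x) = 0"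
    using wd \<phi> \<phi>0 p ab unfolding is_weak_deriv_def by force
  moreover have "integrable (lebesgue_on {0..R}) (\<lambda>x. d x * p x)"
    using d p by (intro continuous_imp_integrable_real continuous_intros) (auto intro: continuous_on_subset)
  ultimately have "integral {0..R} (\<lambda>x. d x * p x) = 0"
    by (subst (asm) lebesgue_integral_eq_integral) auto
  moreover have "integral {a..b} (\<lambda>x. e x * p x) = integral {a..b} (\<lambda>x. d x * p x)"
    by (intro integral_cong) (auto simp: e_def)
  moreover have "integral {a..b} (\<lambda>x. d x * p x) = integral {0..R} (\<lambda>x. d x * p x)"
  proof -
    have "integral {0..R} (\<lambda>x. d x * p x) = integral {0..R} (\<lambda>x. if x \<in> {a..b} then d x * p x else 0)"
      using p0 by (intro integral_cong) auto
    also have "\<dots> = integral {a..b} (\<lambda>x. d x * p x)"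
      using ab by (subst Henstock_Kurzweil_Integration.integral_restrict_Int) (simp add: Int_absorb2)
    finally show ?thesis by simp
  qed
  ultimately have ep: "integral {a..b} (\<lambda>x. e x * p x) = 0" by simp
  have "integral {a..b} (\<lambda>x. (e x - m)\<^sup>2 * \<eta> x) = integral {a..b} (\<lambda>x. e x * p x - m * p x)"
    by (simp add: p_def power2_eq_square algebra_simps)
  also have "\<dots> = 0"
    using ep Ip by (subst integral_diff) (auto intro!: int continuous_intros e p)
  finally have 0: "integral {a..b} (\<lambda>x. (e x - m)\<^sup>2 * \<eta> x) = 0" .
  have sq0: "(e x - m)\<^sup>2 * \<eta> x = 0" if "x \<in> {a..b}" for x
    by (rule zero[OF _ _ 0 that]) (intro continuous_intros e \<eta> mult_nonneg_nonneg \<eta>nn zero_le_power2)+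
  have "d x = m" if "x \<in> {a<..<b}" for x
    using sq0[of x] that \<eta>pos[OF that] by (auto simp: e_def)
  then show ?thesis by blast
qed

text \<open>Every interior point shares with the midpoint \<open>R/2\<close> an interval compactly
  contained in \<open>(0,R)\<close>; continuity carries the common value to both endpoints.\<close>

lemma weak_deriv_zero_imp_constant:
  assumes d: "continuous_on {0..R} d" and wd: "is_weak_deriv R d (\<lambda>_. 0)" and R: "R > 0" and x: "x \<in> {0..R}"
  shows "d x = d R"
proof -
  have const: "d x = d (R/2)" if x: "x \<in> {0<..<R}" for x
  proof -
    define a b where "a = min x (R/2) / 2" "b = (max x (R/2) + R) / 2"
    have "0 < a" "a < b" "b < R" "x \<in> {a<..<b}" "R/2 \<in> {a<..<b}"
      using x by (auto simp: a_b_def min_def max_def)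
    then show ?thesis using du_Bois_Reymond_interval[OF d wd] by metis
  qed
  have "d y = d (R/2)" if "y \<in> {0..R}" for y
  proof (rule continuous_constant_on_closure[of "{0<..<R}" d "d (R/2)"])
    show "continuous_on (closure {0<..<R}) d" using d R by (simp add: closure_greaterThanLessThan)
    show "y \<in> closure {0<..<R}" using that R by (simp add: closure_greaterThanLessThan)
  qed (rule const)
  from this[of R] this[OF x] show ?thesis using R by simp
qed

text \<open>The primitive of \<open>g\<close> also has weak derivative \<open>g\<close>, so its
  difference from \<open>h\<close> is continuous with weak derivative zero, hence constant.\<close>

lemma weak_deriv_eq_primitive:
  assumes "continuous_on {0..R} h" "is_weak_deriv R h g" "L2_on {0..R} g" "R > 0" "x \<in> {0..R}"
  shows "h x = h R - integral {x..R} g"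
proof -
  have "is_weak_deriv R (\<lambda>x. h x + (-1) * - integral {x..R} g) (\<lambda>x. g x + (-1) * g x)"
    by (intro is_weak_deriv_add is_weak_deriv_primitive continuous_on_primitive assms)
  then have "is_weak_deriv R (\<lambda>x. h x + integral {x..R} g) (\<lambda>_. 0)" by simp
  moreover have "continuous_on {0..R} (\<lambda>x. h x + integral {x..R} g)"
    using continuous_on_add[OF assms(1) continuous_on_minus[OF continuous_on_primitive[OF assms(3)]]] by simp
  ultimately have "h x + integral {x..R} g = h R + integral {R..R} g"
    by (intro weak_deriv_zero_imp_constant[of R "\<lambda>x. h x + integral {x..R} g"]) (use assms in auto)
  then show ?thesis by simp
qed

text \<open>Both versions have the same tail integrals, namely increments of \<open>h\<close>. This
  frees the radial energy from the arbitrary choice in \<open>weak_deriv\<close>.\<close>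

lemma weak_deriv_unique:
  assumes "continuous_on {0..R} h" "is_weak_deriv R h g" "is_weak_deriv R h g'" "R > 0"
    "L2_on {0..R} g" "L2_on {0..R} g'"
  shows "AE x in lebesgue_on {0..R}. g x = g' x"
proof -
  note I = L2_on_integrable[OF assms(5)] L2_on_integrable[OF assms(6)]
  have "AE x in lebesgue_on {0..R}. g x - g' x = 0"
  proof (rule integral_zero_imp_AE_zero)
    show "integrable (lebesgue_on {0..R}) (\<lambda>x. g x - g' x)" using I by simp
    fix x assume x: "x \<in> {0..R}"
    have "integral {x..R} (\<lambda>x. g x - g' x) = integral {x..R} g - integral {x..R} g'"
      using x by (intro integral_diff LINT_indicator_subinterval(2)[OF I(1)] LINT_indicator_subinterval(2)[OF I(2)]) auto
    then show "integral {x..R} (\<lambda>x. g x - g' x) = 0"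
      using weak_deriv_eq_primitive[OF assms(1) assms(2) assms(5) assms(4) x]
        weak_deriv_eq_primitive[OF assms(1) assms(3) assms(6) assms(4) x] by simp
  qed
  then show ?thesis by eventually_elim simp
qed

section \<open>Regularity of radial minimizers\<close>

lemma integrable_sum_atMost4:
  fixes A :: "nat \<Rightarrow> 'a \<Rightarrow> real"
  assumes "\<And>i. i \<le> 4 \<Longrightarrow> integrable M (A i)"
  shows "(LINT x|M. (\<Sum>i\<le>4. \<epsilon> ^ i * A i x)) = (\<Sum>i\<le>4. \<epsilon> ^ i * (LINT x|M. A i x))"
proof -
  have "(LINT x|M. (\<Sum>i\<le>4. \<epsilon> ^ i * A i x)) = (\<Sum>i\<le>4. LINT x|M. \<epsilon> ^ i * A i x)"
    using assms by (intro Bochner_Integration.integral_sum integrable_mult_right) auto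
  then show ?thesis by simp
qed

lemma W12_weak_deriv:
  assumes "h \<in> W12 R"
  shows "L2_on {0..R} (weak_deriv R h)" "is_weak_deriv R h (weak_deriv R h)"
proof -
  have "\<exists>g. L2_on {0..R} g \<and> is_weak_deriv R h g"
    using assms by (simp add: W12_def)
  then have "L2_on {0..R} (weak_deriv R h) \<and> is_weak_deriv R h (weak_deriv R h)"
    unfolding weak_deriv_def by (rule someI_ex)
  then show "L2_on {0..R} (weak_deriv R h)" "is_weak_deriv R h (weak_deriv R h)" by auto
qed

lemma radial_energy_eq:
  assumes "R > 0" "continuous_on {0..R} h" "L2_on {0..R} g" "is_weak_deriv R h g"
  shows "radial_energy t R h =
    (LINT r|lebesgue_on {0..R}. r\<^sup>2 / 2 * (g r)\<^sup>2 + 3 * (h r)\<^sup>2 + r\<^sup>2 * bulk_f t (h r))"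
proof -
  let ?M = "lebesgue_on {0..R}"
  have h: "h \<in> W12 R"
    using assms by (auto simp: W12_def intro: continuous_L2_on)
  note wd = W12_weak_deriv[OF h]
  have [measurable]: "h \<in> borel_measurable ?M" "g \<in> borel_measurable ?M" "weak_deriv R h \<in> borel_measurable ?M"
    using assms wd continuous_L2_on[OF assms(2)] by (auto simp: L2_on_def)
  have [measurable]: "(\<lambda>x. x) \<in> borel_measurable ?M"
    using id_borel_measurable_lebesgue_on by (simp add: id_def)
  have [measurable]: "(\<lambda>r. bulk_f t (h r)) \<in> borel_measurable ?M"
    unfolding bulk_f_def by measurable
  have "AE r in ?M. weak_deriv R h r = g r"
    by (rule weak_deriv_unique[OF assms(2) wd(2) assms(4) assms(1) wd(1) assms(3)])
  \<comment> \<open>At \<open>r = 0\<close> the original density is \<open>0\<close> while the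
    simplified one is \<open>3 * (h 0)\<^sup>2\<close>, so this point is removed as a null
    set.\<close>
  moreover have "AE r in ?M. r \<noteq> 0"
    by (rule AE_lebesgue_on_negligible[of "{0}"]) auto
  ultimately have "AE r in ?M. r\<^sup>2 * (1 / 2 * (weak_deriv R h r)\<^sup>2 + 3 * (h r)\<^sup>2 / r\<^sup>2 + bulk_f t (h r)) =
      r\<^sup>2 / 2 * (g r)\<^sup>2 + 3 * (h r)\<^sup>2 + r\<^sup>2 * bulk_f t (h r)"
    by eventually_elim (simp add: field_simps)
  then show ?thesis
    unfolding radial_energy_def by (intro integral_cong_AE) measurable
qed

definition bulk_f' :: "real \<Rightarrow> real \<Rightarrow> real" where
  "bulk_f' t y = - y - 3 * (h_plus t / t) * y\<^sup>2 + 4 * ((h_plus t)\<^sup>2 / (2 * t)) * y ^ 3"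

lemma bulk_f_add:
  "bulk_f t (y + e * z) = bulk_f t y + e * (bulk_f' t y * z)
    + e\<^sup>2 * ((- 1 / 2 - 3 * (h_plus t / t) * y + 6 * ((h_plus t)\<^sup>2 / (2 * t)) * y\<^sup>2) * z\<^sup>2)
    + e ^ 3 * ((4 * ((h_plus t)\<^sup>2 / (2 * t)) * y - h_plus t / t) * z ^ 3)
    + e ^ 4 * (((h_plus t)\<^sup>2 / (2 * t)) * z ^ 4)"
proof -
  \<comment> \<open>Naming the coefficients \<open>p\<close> and \<open>q\<close> hides the division
    by \<open>t\<close> and leaves a polynomial identity.\<close>
  have *: "- (y + e * z)\<^sup>2 / 2 - p * (y + e * z) ^ 3 + q * (y + e * z) ^ 4 + c =
     (- y\<^sup>2 / 2 - p * y ^ 3 + q * y ^ 4 + c) + e * ((- y - 3 * p * y\<^sup>2 + 4 * q * y ^ 3) * z)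
    + e\<^sup>2 * ((- 1 / 2 - 3 * p * y + 6 * q * y\<^sup>2) * z\<^sup>2)
    + e ^ 3 * ((4 * q * y - p) * z ^ 3) + e ^ 4 * (q * z ^ 4)" for p q c :: real
    by algebra
  show ?thesis
    unfolding bulk_f_def bulk_f'_def by (rule *)
qed

lemma polynomial4_local_min_coeff1:
  fixes c :: "nat \<Rightarrow> real"
  assumes "\<And>\<epsilon>. (\<Sum>i\<le>4. \<epsilon> ^ i * c i) \<ge> c 0"
  shows "c 1 = 0"
proof -
  have "((\<lambda>\<epsilon>. \<Sum>i\<le>4. \<epsilon> ^ i * c i) has_real_derivative c 1) (at 0)"
    by (simp add: eval_nat_numeral) (auto intro!: derivative_eq_intros)
  then show ?thesis
    by (rule DERIV_local_min[of _ _ _ 1]) (use assms in \<open>auto simp: eval_nat_numeral\<close>)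
qed

text \<open>Every square-integrable \<open>\<theta>\<close> is the derivative of a variation that vanishes at \<open>R\<close>, namely
  \<open>\<phi> r = - integral {r..R} \<theta>\<close>; no condition at the origin is imposed.\<close>

lemma radial_minimizer_first_variation:
  assumes min: "radial_minimizer t R h" and R: "R > 0" and \<theta>: "L2_on {0..R} \<theta>"
  defines "\<phi> \<equiv> \<lambda>r. - integral {r..R} \<theta>"
  shows "(LINT r|lebesgue_on {0..R}.
    r\<^sup>2 * weak_deriv R h r * \<theta> r + (6 * h r + r\<^sup>2 * bulk_f' t (h r)) * \<phi> r) = 0"
proof -
  let ?M = "lebesgue_on {0..R}"
  define g where "g = weak_deriv R h"
  define p q where "p = h_plus t / t" and "q = (h_plus t)\<^sup>2 / (2 * t)"
  have h: "h \<in> W12 R" "h R = 1" "continuous_on {0..R} h"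
    and le: "\<And>k. k \<in> admissible R \<Longrightarrow> radial_energy t R h \<le> radial_energy t R k"
    using min by (auto simp: radial_minimizer_def is_arg_min_def admissible_def W12_def not_less)
  note g = W12_weak_deriv[OF h(1), folded g_def]
  have \<phi>: "continuous_on {0..R} \<phi>" "is_weak_deriv R \<phi> \<theta>" "\<phi> R = 0"
    using continuous_on_primitive[OF \<theta>] is_weak_deriv_primitive[OF \<theta>] by (auto simp: \<phi>_def)
  \<comment> \<open>\<open>A i\<close> is the coefficient of \<open>\<epsilon> ^ i\<close> in the
    density of \<open>h + \<epsilon> * \<phi>\<close>. The slopes \<open>g\<close> and
    \<open>\<theta>\<close> occur only up to degree two, in products of square-integrable functions;
    everything else is continuous.\<close>
  define A where "A = (\<lambda>i::nat. [
    \<lambda>r. r\<^sup>2 / 2 * (g r)\<^sup>2 + (3 * (h r)\<^sup>2 + r\<^sup>2 * bulk_f t (h r)),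
    \<lambda>r. r\<^sup>2 * g r * \<theta> r + (6 * h r + r\<^sup>2 * bulk_f' t (h r)) * \<phi> r,
    \<lambda>r. r\<^sup>2 / 2 * (\<theta> r)\<^sup>2 + (3 * (\<phi> r)\<^sup>2 + r\<^sup>2 * ((- 1 / 2 - 3 * p * h r + 6 * q * (h r)\<^sup>2) * (\<phi> r)\<^sup>2)),
    \<lambda>r. r\<^sup>2 * ((4 * q * h r - p) * (\<phi> r) ^ 3),
    \<lambda>r. r\<^sup>2 * (q * (\<phi> r) ^ 4)] ! i)"
  have sq: "integrable ?M (\<lambda>r. c * r\<^sup>2 * u r * v r)" if "L2_on {0..R} u" "L2_on {0..R} v" for u v c
    by (intro L2_on_mult L2_on_continuous_mult continuous_intros that)
  have int: "integrable ?M (A i)" if "i \<le> 4" for i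
  proof -
    have "integrable ?M (\<lambda>r. r\<^sup>2 / 2 * (g r)\<^sup>2)" "integrable ?M (\<lambda>r. r\<^sup>2 / 2 * (\<theta> r)\<^sup>2)"
      "integrable ?M (\<lambda>r. r\<^sup>2 * g r * \<theta> r)"
      using sq[OF g(1) g(1), of "1/2"] sq[OF \<theta> \<theta>, of "1/2"] sq[OF g(1) \<theta>, of 1]
      by (simp_all add: power2_eq_square mult.assoc)
    moreover have
      "integrable ?M (\<lambda>r. 3 * (h r)\<^sup>2 + r\<^sup>2 * bulk_f t (h r))"
      "integrable ?M (\<lambda>r. (6 * h r + r\<^sup>2 * bulk_f' t (h r)) * \<phi> r)"
      "integrable ?M (\<lambda>r. 3 * (\<phi> r)\<^sup>2 + r\<^sup>2 * ((- 1 / 2 - 3 * p * h r + 6 * q * (h r)\<^sup>2) * (\<phi> r)\<^sup>2))"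
      "integrable ?M (\<lambda>r. r\<^sup>2 * ((4 * q * h r - p) * (\<phi> r) ^ 3))"
      "integrable ?M (\<lambda>r. r\<^sup>2 * (q * (\<phi> r) ^ 4))"
      unfolding bulk_f_def bulk_f'_def p_def[symmetric] q_def[symmetric]
      by (intro continuous_imp_integrable_real continuous_intros h \<phi>; simp)+
    moreover have "i = 0 \<or> i = 1 \<or> i = 2 \<or> i = 3 \<or> i = 4" using that by auto
    ultimately show ?thesis
      by (elim disjE) (simp_all add: A_def nth_Cons' Bochner_Integration.integrable_add)
  qed
  have energy: "radial_energy t R (\<lambda>r. h r + \<epsilon> * \<phi> r) = (\<Sum>i\<le>4. \<epsilon> ^ i * (LINT r|?M. A i r))" for \<epsilon>
  proof -
    have "radial_energy t R (\<lambda>r. h r + \<epsilon> * \<phi> r) =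
      (LINT r|?M. r\<^sup>2 / 2 * (g r + \<epsilon> * \<theta> r)\<^sup>2 + 3 * (h r + \<epsilon> * \<phi> r)\<^sup>2 + r\<^sup>2 * bulk_f t (h r + \<epsilon> * \<phi> r))"
      by (intro radial_energy_eq R is_weak_deriv_add L2_on_add continuous_intros h \<phi> g \<theta>)
    also have "\<dots> = (LINT r|?M. (\<Sum>i\<le>4. \<epsilon> ^ i * A i r))"
    proof (rule Bochner_Integration.integral_cong[OF refl])
      fix r
      show "r\<^sup>2 / 2 * (g r + \<epsilon> * \<theta> r)\<^sup>2 + 3 * (h r + \<epsilon> * \<phi> r)\<^sup>2 + r\<^sup>2 * bulk_f t (h r + \<epsilon> * \<phi> r) =
        (\<Sum>i\<le>4. \<epsilon> ^ i * A i r)"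
        unfolding bulk_f_add p_def[symmetric] q_def[symmetric]
        by (simp add: eval_nat_numeral A_def nth_Cons') (simp add: field_simps)
    qed
    also have "\<dots> = (\<Sum>i\<le>4. \<epsilon> ^ i * (LINT r|?M. A i r))"
      by (rule integrable_sum_atMost4[OF int])
    finally show ?thesis .
  qed
  have "(LINT r|?M. A 0 r) \<le> (\<Sum>i\<le>4. \<epsilon> ^ i * (LINT r|?M. A i r))" for \<epsilon>
  proof -
    have "is_weak_deriv R (\<lambda>r. h r + \<epsilon> * \<phi> r) (\<lambda>r. g r + \<epsilon> * \<theta> r)" "L2_on {0..R} (\<lambda>r. g r + \<epsilon> * \<theta> r)"
      "continuous_on {0..R} (\<lambda>r. h r + \<epsilon> * \<phi> r)"
      by (intro is_weak_deriv_add L2_on_add continuous_intros h \<phi> g \<theta>)+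
    then have "(\<lambda>r. h r + \<epsilon> * \<phi> r) \<in> admissible R"
      unfolding admissible_def W12_def using \<phi>(3) h(2) by (auto intro: continuous_L2_on)
    from le[OF this] energy[of \<epsilon>] energy[of 0] show ?thesis
      by (simp add: eval_nat_numeral)
  qed
  then have "(LINT r|?M. A 1 r) = 0"
    by (rule polynomial4_local_min_coeff1)
  then show ?thesis by (simp add: A_def g_def)
qed

lemma radial_minimizer_weak_deriv:
  assumes min: "radial_minimizer t R h" and R: "R > 0"
  defines "W \<equiv> \<lambda>r. integral {0..r} (\<lambda>s. 6 * h s + s\<^sup>2 * bulk_f' t (h s))"
  shows "AE r in lebesgue_on {0..R}. r\<^sup>2 * weak_deriv R h r = W r"
proof -
  let ?M = "lebesgue_on {0..R}"
  define g where "g = weak_deriv R h"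
  define w where "w = (\<lambda>s. 6 * h s + s\<^sup>2 * bulk_f' t (h s))"
  have h: "h \<in> W12 R" "continuous_on {0..R} h"
    using min by (auto simp: radial_minimizer_def is_arg_min_def admissible_def W12_def)
  note g = W12_weak_deriv(1)[OF h(1), folded g_def]
  have w: "continuous_on {0..R} w"
    unfolding w_def bulk_f'_def by (intro continuous_intros h)
  have W: "continuous_on {0..R} W"
    unfolding W_def w_def[symmetric]
    by (intro indefinite_integral_continuous_1 integrable_continuous_real w)
  define \<theta> where "\<theta> = (\<lambda>r. r\<^sup>2 * g r + (-1) * W r)"
  have rg: "L2_on {0..R} (\<lambda>r. r\<^sup>2 * g r)"
    by (intro L2_on_continuous_mult g continuous_intros)
  have \<theta>: "L2_on {0..R} \<theta>"
    unfolding \<theta>_def by (intro L2_on_add rg continuous_L2_on W)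
  have I: "integrable ?M (\<lambda>r. r\<^sup>2 * g r * \<theta> r)" "integrable ?M (\<lambda>r. W r * \<theta> r)"
    "integrable ?M (\<lambda>r. w r * integral {r..R} \<theta>)"
  proof -
    show "integrable ?M (\<lambda>r. r\<^sup>2 * g r * \<theta> r)" "integrable ?M (\<lambda>r. W r * \<theta> r)"
      by (intro L2_on_mult rg \<theta> continuous_L2_on W)+
    have "continuous_on {0..R} (\<lambda>r. w r * - (- integral {r..R} \<theta>))"
      by (intro continuous_on_mult w continuous_on_minus continuous_on_primitive \<theta>)
    then show "integrable ?M (\<lambda>r. w r * integral {r..R} \<theta>)"
      using continuous_imp_integrable_real by simp
  qed
  have "0 = (LINT r|?M. r\<^sup>2 * g r * \<theta> r - w r * integral {r..R} \<theta>)"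
    using radial_minimizer_first_variation[OF min R \<theta>] by (simp add: g_def w_def)
  also have "\<dots> = (LINT r|?M. r\<^sup>2 * g r * \<theta> r) - (LINT r|?M. w r * integral {r..R} \<theta>)"
    using I by simp
  \<comment> \<open>The swap trades the tail integral of \<open>\<theta>\<close> for the primitive
    \<open>W\<close> of \<open>w\<close>, with no boundary term at either end.\<close>
  also have "(LINT r|?M. w r * integral {r..R} \<theta>) = (LINT r|?M. \<theta> r * W r)"
    unfolding W_def w_def[symmetric]
    by (intro integral_swap_triangle L2_on_integrable[OF \<theta>] continuous_imp_integrable_real w)
  also have "(LINT r|?M. r\<^sup>2 * g r * \<theta> r) - (LINT r|?M. \<theta> r * W r) = (LINT r|?M. r\<^sup>2 * g r * \<theta> r - W r * \<theta> r)"
    using I by (simp add: mult.commute)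
  also have "\<dots> = (LINT r|?M. (\<theta> r)\<^sup>2)"
    by (simp add: \<theta>_def power2_eq_square algebra_simps)
  finally have "(LINT r|?M. (\<theta> r)\<^sup>2) = 0" by simp
  then have "AE r in ?M. (\<theta> r)\<^sup>2 = 0"
    using \<theta> by (subst (asm) integral_nonneg_eq_0_iff_AE) (auto simp: L2_on_def)
  then show ?thesis
    by eventually_elim (simp add: \<theta>_def g_def)
qed

lemma radial_minimizer_regular:
  assumes min: "radial_minimizer t R h" and R: "R > 0"
  obtains G K where "continuous_on {0..R} h" "continuous_on {0<..<R} G"
    "\<And>r. r \<in> {0<..<R} \<Longrightarrow> (h has_real_derivative G r) (at r)"
    "\<And>r. r \<in> {0<..<R} \<Longrightarrow> \<bar>G r\<bar> \<le> K / r"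
proof -
  define w where "w = (\<lambda>s. 6 * h s + s\<^sup>2 * bulk_f' t (h s))"
  define W where "W = (\<lambda>r. integral {0..r} w)"
  define g where "g = weak_deriv R h"
  define G where "G = (\<lambda>r. W r / r\<^sup>2)"
  have h: "h \<in> W12 R" "continuous_on {0..R} h"
    using min by (auto simp: radial_minimizer_def is_arg_min_def admissible_def W12_def)
  note g = W12_weak_deriv[OF h(1), folded g_def]
  have w: "continuous_on {0..R} w"
    unfolding w_def bulk_f'_def by (intro continuous_intros h)
  have W: "continuous_on {0..R} W"
    unfolding W_def by (intro indefinite_integral_continuous_1 integrable_continuous_real w)
  have "bounded (w ` {0..R})"
    using w by (intro compact_imp_bounded compact_continuous_image) auto
  then obtain K where "\<forall>y\<in>w ` {0..R}. norm y \<le> K"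
    unfolding bounded_iff by blast
  then have K: "\<bar>w r\<bar> \<le> K" if "r \<in> {0..R}" for r
    using that by simp
  \<comment> \<open>\<open>W\<close> is the integral of a bounded function from the origin, hence
    \<open>O(r)\<close>; dividing by \<open>r\<^sup>2\<close> leaves the bound
    \<open>K / r\<close>.\<close>
  have Wb: "\<bar>W r\<bar> \<le> K * r" if "r \<in> {0..R}" for r
  proof -
    have "norm (integral {0..r} w) \<le> K * (r - 0)"
      using K that by (intro integral_bound continuous_on_subset[OF w]) auto
    then show ?thesis by (simp add: W_def)
  qed
  have G: "continuous_on {0<..R} G"
    unfolding G_def by (intro continuous_intros continuous_on_subset[OF W]) auto
  have "AE r in lebesgue_on {0..R}. r \<noteq> 0"
    by (rule AE_lebesgue_on_negligible[of "{0}"]) auto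
  with radial_minimizer_weak_deriv[OF min R] have "AE r in lebesgue_on {0..R}. g r = G r"
    unfolding W_def w_def g_def G_def by eventually_elim (simp add: field_simps)
  then obtain N where N: "N \<in> null_sets (lebesgue_on {0..R})" "{r \<in> {0..R}. g r \<noteq> G r} \<subseteq> N"
    by (auto simp: eventually_ae_filter)
  then have "N \<in> null_sets lebesgue"
    by (subst (asm) null_sets_restrict_space) auto
  have N3: "g r = G r" if "r \<in> {0..R}" "r \<notin> N" for r
    using N(2) that by auto
  from \<open>N \<in> null_sets lebesgue\<close> have N': "negligible N" by (simp add: negligible_iff_null_sets)
  \<comment> \<open>\<open>g\<close> and \<open>G\<close> differ only on a null set, so
    \<open>h\<close> is also a primitive of \<open>G\<close>, which is continuous away from the
    origin.\<close>
  have hG: "h x = h R - integral {x..R} G" if "x \<in> {0..R}" for x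
  proof -
    have "integral {x..R} g = integral {x..R} G"
      by (rule integral_spike[OF N']) (use N3 that in auto)
    with weak_deriv_eq_primitive[OF h(2) g(2,1) R that] show ?thesis by simp
  qed
  have "(h has_real_derivative G r) (at r)" if r: "r \<in> {0<..<R}" for r
  proof -
    \<comment> \<open>Starting at \<open>r/2\<close> keeps the possible singularity of
      \<open>G\<close> at the origin out of the interval, while \<open>r\<close> remains an interior
      point, so the derivative is two-sided.\<close>
    have "((\<lambda>x. integral {x..R} G) has_real_derivative - G r) (at r within {r/2..R})"
      using r by (intro integral_has_real_derivative' continuous_on_subset[OF G]) auto
    moreover have "at r within {r/2..R} = at r"
      using r by (intro at_within_interior) auto
    ultimately have "((\<lambda>x. h R - integral {x..R} G) has_real_derivative G r) (at r)"
      by (auto intro!: derivative_eq_intros)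
    moreover have "eventually (\<lambda>x. x \<in> {0<..<R}) (nhds r)"
      using r by (intro eventually_nhds_in_open) auto
    then have "eventually (\<lambda>x. h R - integral {x..R} G = h x) (nhds r)"
    proof (rule eventually_mono)
      fix x assume "x \<in> {0<..<R}"
      then show "h R - integral {x..R} G = h x" using hG[of x] by simp
    qed
    ultimately show ?thesis
      by (subst DERIV_cong_ev[OF refl _ refl, symmetric])
  qed
  moreover have "\<bar>G r\<bar> \<le> K / r" if "r \<in> {0<..<R}" for r
    using Wb[of r] that by (simp add: G_def field_simps power2_eq_square)
  moreover have "continuous_on {0<..<R} G"
    by (rule continuous_on_subset[OF G]) auto
  ultimately show thesis using that h(2) by blast
qed

section \<open>A Poincare inequality on the ball\<close>

lemma compact_continuous_imp_integrable:
  fixes f :: "'a::euclidean_space \<Rightarrow> 'b::euclidean_space"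
  assumes "compact S" "continuous_on S f"
  shows "integrable (lebesgue_on S) f"
proof -
  have "(\<lambda>x. indicator S x *\<^sub>R f x) \<in> borel_measurable lborel"
    using borel_measurable_continuous_on_indicator[OF _ assms(2)] compact_imp_closed[OF assms(1)] by simp
  then have "integrable lebesgue (\<lambda>x. indicator S x *\<^sub>R f x)"
    using borel_integrable_compact[OF assms] by (simp add: integrable_completion)
  then show ?thesis
    using compact_imp_closed[OF assms(1)] by (subst integrable_restrict_space) auto
qed

text \<open>\<open>C_k_on\<close> yields continuity of the derivative along basis vectors only. The
  sum of the resulting bounds controls the operator norm, and the mean value inequality on a convex
  set does the rest.\<close>

lemma continuous_derivative_imp_Lipschitz:
  fixes P :: "'a::euclidean_space \<Rightarrow> 'b::real_normed_vector"
  assumes S: "compact S" "convex S"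
    and P: "\<And>x. x \<in> S \<Longrightarrow> (P has_derivative P' x) (at x)"
    and P': "\<And>v. v \<in> Basis \<Longrightarrow> continuous_on S (\<lambda>x. P' x v)"
  obtains L where "L \<ge> 0" "\<And>x y. x \<in> S \<Longrightarrow> y \<in> S \<Longrightarrow> norm (P x - P y) \<le> L * norm (x - y)"
proof -
  have "\<exists>B. \<forall>x\<in>S. norm (P' x v) \<le> B" if "v \<in> Basis" for v
  proof -
    have "bounded ((\<lambda>x. P' x v) ` S)"
      using S P'[OF that] by (intro compact_imp_bounded compact_continuous_image)
    then show ?thesis by (auto simp: bounded_iff)
  qed
  then obtain B where B: "\<And>v x. v \<in> Basis \<Longrightarrow> x \<in> S \<Longrightarrow> norm (P' x v) \<le> B v"
    by metis
  define L where "L = (\<Sum>v\<in>Basis. \<bar>B v\<bar>)"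
  have L: "onorm (P' x) \<le> L" if x: "x \<in> S" for x
  proof (rule onorm_bound)
    fix w :: 'a
    interpret linear "P' x" using P[OF x] by (rule has_derivative_linear)
    have "P' x w = (\<Sum>v\<in>Basis. (w \<bullet> v) *\<^sub>R P' x v)"
      by (subst euclidean_representation[of w, symmetric]) (simp add: sum scaleR)
    also have "norm \<dots> \<le> (\<Sum>v\<in>Basis. norm w * \<bar>B v\<bar>)"
    proof (rule sum_norm_le)
      fix v :: 'a assume v: "v \<in> Basis"
      show "norm ((w \<bullet> v) *\<^sub>R P' x v) \<le> norm w * \<bar>B v\<bar>"
        unfolding norm_scaleR using B[OF v x] Basis_le_norm[OF v, of w] by (intro mult_mono) auto
    qed
    finally show "norm (P' x w) \<le> L * norm w"
      by (simp add: L_def sum_distrib_left mult.commute)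
  qed (simp add: L_def sum_nonneg)
  show thesis
  proof
    show "L \<ge> 0" by (simp add: L_def sum_nonneg)
    show "norm (P x - P y) \<le> L * norm (x - y)" if "x \<in> S" "y \<in> S" for x y
      using differentiable_bound[OF S(2) has_derivative_at_withinI[OF P] L that] .
  qed
qed

text \<open>Composing with the metric projection onto the ball extends a map vanishing on the sphere by
  zero, and preserves its Lipschitz constant.\<close>

lemma closest_point_cball_outside:
  fixes x :: "'a::euclidean_space"
  assumes "R > 0" "norm x \<ge> R"
  shows "closest_point (cball 0 R) x \<in> sphere 0 R"
proof (cases "norm x = R")
  case True
  then show ?thesis by (simp add: closest_point_self)
next
  case False
  then have "closest_point (cball 0 R) x \<in> rel_frontier (cball 0 R)"
    using assms by (intro closest_point_in_rel_frontier)
      (auto simp: rel_interior_nonempty_interior affine_hull_nonempty_interior)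
  also have "rel_frontier (cball 0 R) = sphere (0::'a) R"
    using assms by (simp add: rel_frontier_nonempty_interior)
  finally show ?thesis .
qed

text \<open>This is the divergence theorem for the field
  \<open>(x \<bullet> e) * (norm (P x))\<^sup>2\<close> times \<open>e\<close>, whose flux through
  the sphere is zero. By translation invariance, the difference quotients of its zero extension
  integrate to zero over the whole space; a Lipschitz bound lets the step tend to zero under the
  integral.\<close>

lemma integral_cball_translation_derivative:
  fixes P :: "'a::euclidean_space \<Rightarrow> 'b::euclidean_space"
  assumes R: "R > 0"
    and P: "\<And>x. x \<in> cball 0 R \<Longrightarrow> (P has_derivative P' x) (at x)"
    and P': "\<And>v. v \<in> Basis \<Longrightarrow> continuous_on (cball 0 R) (\<lambda>x. P' x v)"
    and P0: "\<And>x. x \<in> sphere 0 R \<Longrightarrow> P x = 0"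
    and e: "e \<in> Basis"
  shows "(LINT x|lebesgue_on (cball 0 R). (norm (P x))\<^sup>2 + 2 * (x \<bullet> e) * (P x \<bullet> P' x e)) = 0"
proof -
  define S where "S = cball (0::'a) R"
  obtain L where L: "L \<ge> 0" "\<And>x y. x \<in> S \<Longrightarrow> y \<in> S \<Longrightarrow> norm (P x - P y) \<le> L * norm (x - y)"
    by (rule continuous_derivative_imp_Lipschitz[of S P P']) (use P P' in \<open>auto simp: S_def\<close>)
  have contP: "continuous_on S P"
    using P by (auto intro!: continuous_at_imp_continuous_on has_derivative_continuous simp: S_def)
  have "bounded (P ` S)"
    using contP by (intro compact_imp_bounded compact_continuous_image) (auto simp: S_def)
  then obtain M where "\<forall>y\<in>P ` S. norm y \<le> M"
    unfolding bounded_iff by blast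
  then have M: "norm (P x) \<le> M" if "x \<in> S" for x using that by simp
  have M0: "M \<ge> 0" using M[of 0] R norm_ge_zero[of "P 0"] by (auto simp: S_def simp del: norm_ge_zero)
  define Q where "Q = (\<lambda>x. P (closest_point S x))"
  have cp: "closest_point S x \<in> S" for x
    using R by (intro closest_point_in_set) (auto simp: S_def)
  have Q_eq: "Q x = P x" if "x \<in> S" for x
    using that by (simp add: Q_def closest_point_self)
  have Q_0: "Q x = 0" if "norm x \<ge> R" for x
    using closest_point_cball_outside[OF R that] P0 by (simp add: Q_def S_def)
  have Q_M: "norm (Q x) \<le> M" for x
    using M[OF cp] by (simp add: Q_def)
  have Q_L: "norm (Q x - Q y) \<le> L * norm (x - y)" for x y
  proof -
    have "dist (closest_point S x) (closest_point S y) \<le> dist x y"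
      using R by (intro closest_point_lipschitz) (auto simp: S_def)
    then show ?thesis
      using L(2)[OF cp[of x] cp[of y]] L(1) unfolding Q_def dist_norm
      by (meson mult_left_mono order_trans)
  qed
  have contQ: "continuous_on UNIV Q"
  proof -
    have "continuous_on UNIV (closest_point S)"
      using R by (intro continuous_on_closest_point) (auto simp: S_def)
    then show ?thesis
      unfolding Q_def by (rule continuous_on_compose2[OF contP]) (use cp in blast)
  qed
  define u where "u = (\<lambda>x. (x \<bullet> e) * (norm (Q x))\<^sup>2)"
  have contu: "continuous_on UNIV u"
    unfolding u_def by (intro continuous_intros contQ)
  then have [measurable]: "u \<in> borel_measurable borel"
    by (rule borel_measurable_continuous_onI)
  have u0: "u x = 0" if "norm x \<ge> R" for x
    using Q_0[OF that] by (simp add: u_def)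
  \<comment> \<open>The Lipschitz constant of a product. \<open>R + 2\<close> bounds the translated
    point: the dominating function lives on the ball of radius \<open>R + 1\<close>, and the step is
    at most \<open>1\<close>.\<close>
  define B where "B = M\<^sup>2 + (R + 2) * (2 * M * L)"
  have B0: "B \<ge> 0" using M0 L(1) R by (simp add: B_def)
  have uL: "\<bar>u x - u y\<bar> \<le> B * norm (x - y)" if "norm y \<le> R + 2" for x y
  proof -
    have n2: "\<bar>(norm (Q x))\<^sup>2 - (norm (Q y))\<^sup>2\<bar> \<le> 2 * M * L * norm (x - y)"
    proof -
      have "(norm (Q x))\<^sup>2 - (norm (Q y))\<^sup>2 = (norm (Q x) - norm (Q y)) * (norm (Q x) + norm (Q y))"
        by (simp add: power2_eq_square algebra_simps)
      also have "\<bar>\<dots>\<bar> \<le> (L * norm (x - y)) * (2 * M)"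
        unfolding abs_mult
        using Q_M[of x] Q_M[of y] Q_L[of x y] norm_triangle_ineq3[of "Q x" "Q y"] L(1)
        by (intro mult_mono) auto
      finally show ?thesis by (simp add: mult_ac)
    qed
    have "u x - u y = ((x - y) \<bullet> e) * (norm (Q x))\<^sup>2 + (y \<bullet> e) * ((norm (Q x))\<^sup>2 - (norm (Q y))\<^sup>2)"
      by (simp add: u_def inner_diff_left algebra_simps)
    also have "\<bar>\<dots>\<bar> \<le> \<bar>(x - y) \<bullet> e\<bar> * (norm (Q x))\<^sup>2 + \<bar>y \<bullet> e\<bar> * \<bar>(norm (Q x))\<^sup>2 - (norm (Q y))\<^sup>2\<bar>"
      by (rule order_trans[OF abs_triangle_ineq]) (simp add: abs_mult)
    also have "\<dots> \<le> norm (x - y) * M\<^sup>2 + (R + 2) * (2 * M * L * norm (x - y))"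
      using Basis_le_norm[OF e, of "x - y"] Basis_le_norm[OF e, of y] that Q_M[of x] n2 R
      by (intro add_mono mult_mono power_mono) auto
    finally show ?thesis by (simp add: B_def algebra_simps)
  qed
  define s where "s = (\<lambda>n::nat. 1 / real (Suc n))"
  have s: "0 < s n" "s n \<le> 1" for n by (auto simp: s_def)
  have s_lim: "filterlim s (at 0) sequentially"
    using s LIMSEQ_inverse_real_of_nat unfolding filterlim_at
    by (auto simp: s_def inverse_eq_divide)
  define d where "d = (\<lambda>n x. (u (x + s n *\<^sub>R e) - u x) / s n)"
  have u_int: "integrable lborel u"
  proof -
    have "integrable lborel (\<lambda>x. indicator (cball 0 R) x *\<^sub>R u x)"
      by (intro borel_integrable_compact continuous_on_subset[OF contu]) auto
    also have "(\<lambda>x. indicator (cball 0 R) x *\<^sub>R u x) = u"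
      using u0 by (force simp: indicator_def)
    finally show ?thesis .
  qed
  have d_int: "integral\<^sup>L lborel (d n) = 0" for n
  proof -
    have "integrable (distr lborel borel ((+) (s n *\<^sub>R e))) u"
      "integral\<^sup>L (distr lborel borel ((+) (s n *\<^sub>R e))) u = integral\<^sup>L lborel u"
      using u_int by (simp_all add: lborel_distr_plus)
    then have "integrable lborel (\<lambda>x. u (x + s n *\<^sub>R e))" "(LINT x|lborel. u (x + s n *\<^sub>R e)) = integral\<^sup>L lborel u"
      by (simp_all add: integrable_distr_eq integral_distr add.commute)
    then show ?thesis using u_int by (simp add: d_def)
  qed
  define D where "D = (\<lambda>x. (norm (P x))\<^sup>2 + 2 * (x \<bullet> e) * (P x \<bullet> P' x e))"
  have contD: "continuous_on S D"
    unfolding D_def by (intro continuous_intros contP P'[OF e, folded S_def])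
  \<comment> \<open>The extension by zero may have a kink on the sphere, so convergence is claimed
    only off this null set.\<close>
  have lim: "(\<lambda>n. d n x) \<longlonglongrightarrow> indicator S x *\<^sub>R D x" if x: "x \<notin> sphere 0 R" for x
  proof (cases "x \<in> ball 0 R")
    case True
    then have xS: "x \<in> S" by (simp add: S_def)
    have "eventually (\<lambda>y. y \<in> ball 0 R) (nhds x)"
      using True by (intro eventually_nhds_in_open) auto
    then have "eventually (\<lambda>y. P y = Q y) (nhds x)"
      by eventually_elim (simp add: Q_eq S_def)
    then have "(Q has_derivative P' x) (at x)"
      using P[of x] xS by (simp add: S_def has_derivative_transform_eventually eventually_nhds_conv_at Q_eq)
    then have Q': "(Q has_derivative P' x) (at (x + 0 *\<^sub>R e))"
      by simp
    interpret linear "P' x" using Q' by (rule has_derivative_linear)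
    have "((\<lambda>r. x + r *\<^sub>R e) has_derivative (\<lambda>r. r *\<^sub>R e)) (at 0)"
      by (auto intro!: derivative_eq_intros)
    from diff_chain_at[OF this Q']
    have "((\<lambda>r. Q (x + r *\<^sub>R e)) has_vector_derivative P' x e) (at 0)"
      by (simp add: has_vector_derivative_def o_def scaleR)
    note Q'' = this[unfolded has_vector_derivative_def]
    have "((\<lambda>r. (norm (Q (x + r *\<^sub>R e)))\<^sup>2) has_real_derivative 2 * (P x \<bullet> P' x e)) (at 0)"
      using has_derivative_inner[OF Q'' Q''] Q_eq[OF xS]
      by (simp add: has_field_derivative_def power2_norm_eq_inner inner_commute algebra_simps)
        (erule has_derivative_eq_rhs; auto simp: fun_eq_iff)
    moreover have "((\<lambda>r. (x + r *\<^sub>R e) \<bullet> e) has_real_derivative 1) (at 0)"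
      using e by (auto intro!: derivative_eq_intros simp: inner_add_left)
    ultimately have "((\<lambda>r. u (x + r *\<^sub>R e)) has_real_derivative D x) (at 0)"
      unfolding u_def D_def
      using DERIV_mult[where f = "\<lambda>r. (x + r *\<^sub>R e) \<bullet> e" and g = "\<lambda>r. (norm (Q (x + r *\<^sub>R e)))\<^sup>2" and s = UNIV and x = 0]
        Q_eq[OF xS]
      by (fastforce simp: algebra_simps intro: DERIV_cong)
    then have "((\<lambda>r. (u (x + r *\<^sub>R e) - u x) / r) \<longlongrightarrow> D x) (at 0)"
      by (simp add: DERIV_def)
    then show ?thesis
      using filterlim_compose[OF _ s_lim] xS unfolding d_def by fastforce
  next
    case False
    then have xR: "norm x > R" using x by auto
    have "eventually (\<lambda>y. y \<in> - cball 0 R) (nhds x)"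
      using xR by (intro eventually_nhds_in_open) auto
    moreover have "((\<lambda>n. x + s n *\<^sub>R e) \<longlongrightarrow> x + 0 *\<^sub>R e) sequentially"
      using s_lim by (intro tendsto_intros) (auto simp: filterlim_at)
    ultimately have "eventually (\<lambda>n. x + s n *\<^sub>R e \<in> - cball 0 R) sequentially"
      by (auto simp: filterlim_iff)
    then have "eventually (\<lambda>n. d n x = indicator S x *\<^sub>R D x) sequentially"
      by eventually_elim (use xR u0 in \<open>auto simp: d_def S_def\<close>)
    then show ?thesis by (rule tendsto_eventually)
  qed
  have "(\<lambda>n. integral\<^sup>L lborel (d n)) \<longlonglongrightarrow> (LINT x|lborel. indicator S x *\<^sub>R D x)"
  proof (rule integral_dominated_convergence[where w = "\<lambda>x. indicator (cball 0 (R + 1)) x *\<^sub>R B"])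
    show "(\<lambda>x. indicator S x *\<^sub>R D x) \<in> borel_measurable lborel"
      using borel_measurable_continuous_on_indicator[OF _ contD] by (simp add: S_def)
    show "d n \<in> borel_measurable lborel" for n
      unfolding d_def by measurable
    show "integrable lborel (\<lambda>x. indicator (cball 0 (R + 1)) x *\<^sub>R B)"
      by (intro borel_integrable_compact) auto
    have "sphere (0::'a) R \<in> null_sets lborel"
      using negligible_sphere[of "0::'a" R] by (auto simp: null_sets_completion_iff negligible_iff_null_sets)
    then show "AE x in lborel. (\<lambda>n. d n x) \<longlonglongrightarrow> indicator S x *\<^sub>R D x"
      by (rule AE_I') (use lim in blast)
    show "AE x in lborel. norm (d n x) \<le> indicator (cball 0 (R + 1)) x *\<^sub>R B" for n
    proof (intro AE_I2)
      fix x
      have se: "norm (s n *\<^sub>R e) = s n" using s[of n] e by simp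
      show "norm (d n x) \<le> indicator (cball 0 (R + 1)) x *\<^sub>R B"
      proof (cases "norm x \<le> R + 1")
        case True
        then have "\<bar>u (x + s n *\<^sub>R e) - u x\<bar> \<le> B * s n"
          using uL[of x "x + s n *\<^sub>R e"] se by simp
        then show ?thesis using True s[of n] by (simp add: d_def field_simps)
      next
        case False
        have "norm x \<le> norm (x + s n *\<^sub>R e) + norm (s n *\<^sub>R e)"
          using norm_triangle_ineq4[of "x + s n *\<^sub>R e" "s n *\<^sub>R e"] by simp
        then have "u (x + s n *\<^sub>R e) = 0" "u x = 0" using False se s[of n] R by (auto intro!: u0)
        then show ?thesis using False by (simp add: d_def)
      qed
    qed
  qed
  then have "(LINT x|lborel. indicator S x *\<^sub>R D x) = 0"
    using d_int LIMSEQ_unique[OF tendsto_const] by fastforce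
  moreover have "(LINT x|lborel. indicator S x *\<^sub>R D x) = (LINT x|lebesgue. indicator S x *\<^sub>R D x)"
    using borel_measurable_continuous_on_indicator[OF _ contD]
    by (intro integral_completion[symmetric]) (simp add: S_def)
  moreover have "\<dots> = (LINT x|lebesgue_on S. D x)"
    by (intro integral_restrict_space[symmetric]) (simp add: S_def)
  ultimately show ?thesis by (simp add: S_def D_def)
qed

lemma Poincare_cball:
  fixes P :: "'a::euclidean_space \<Rightarrow> 'b::euclidean_space"
  assumes R: "R > 0"
    and P: "\<And>x. x \<in> cball 0 R \<Longrightarrow> (P has_derivative P' x) (at x)"
    and P': "\<And>v. v \<in> Basis \<Longrightarrow> continuous_on (cball 0 R) (\<lambda>x. P' x v)"
    and P0: "\<And>x. x \<in> sphere 0 R \<Longrightarrow> P x = 0"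
    and e: "e \<in> Basis"
  shows "(LINT x|lebesgue_on (cball 0 R). (norm (P x))\<^sup>2) \<le>
    4 * R\<^sup>2 * (LINT x|lebesgue_on (cball 0 R). (norm (P' x e))\<^sup>2)"
proof -
  let ?M = "lebesgue_on (cball (0::'a) R)"
  have contP: "continuous_on (cball 0 R) P"
    using P by (auto intro!: continuous_at_imp_continuous_on has_derivative_continuous)
  have int: "integrable ?M f" if "continuous_on (cball 0 R) f" for f :: "'a \<Rightarrow> real"
    using that by (intro compact_continuous_imp_integrable) auto
  note c = contP P'[OF e]
  have "0 = (LINT x|?M. (norm (P x))\<^sup>2 + 2 * (x \<bullet> e) * (P x \<bullet> P' x e))"
    using integral_cball_translation_derivative[OF assms] by simp
  also have "\<dots> \<ge> (LINT x|?M. 1 / 2 * (norm (P x))\<^sup>2 - 2 * R\<^sup>2 * (norm (P' x e))\<^sup>2)"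
  proof (rule integral_mono)
    fix x assume "x \<in> space ?M"
    then have x: "norm x \<le> R" by simp
    define a b where "a = norm (P x)" "b = norm (P' x e)"
    have "\<bar>(x \<bullet> e) * (P x \<bullet> P' x e)\<bar> \<le> R * (a * b)"
      unfolding abs_mult a_b_def using Cauchy_Schwarz_ineq2[of "P x" "P' x e"] Basis_le_norm[OF e, of x] x R
      by (intro mult_mono) auto
    \<comment> \<open>The weights of this Young inequality leave exactly half of
      \<open>a\<^sup>2\<close> after absorption; doubling then produces the constant
      \<open>4 * R\<^sup>2\<close>.\<close>
    moreover have "(a - 2 * R * b)\<^sup>2 \<ge> 0" by simp
    then have "2 * (R * (a * b)) \<le> a\<^sup>2 / 2 + 2 * R\<^sup>2 * b\<^sup>2"
      by (simp add: power2_eq_square algebra_simps)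
    ultimately have "1 / 2 * a\<^sup>2 - 2 * R\<^sup>2 * b\<^sup>2 \<le> a\<^sup>2 + 2 * ((x \<bullet> e) * (P x \<bullet> P' x e))"
      by linarith
    then show "1 / 2 * (norm (P x))\<^sup>2 - 2 * R\<^sup>2 * (norm (P' x e))\<^sup>2 \<le> (norm (P x))\<^sup>2 + 2 * (x \<bullet> e) * (P x \<bullet> P' x e)"
      by (simp add: a_b_def mult.assoc)
  qed (intro int continuous_intros c)+
  also have "(LINT x|?M. 1 / 2 * (norm (P x))\<^sup>2 - 2 * R\<^sup>2 * (norm (P' x e))\<^sup>2) =
      1 / 2 * (LINT x|?M. (norm (P x))\<^sup>2) - 2 * R\<^sup>2 * (LINT x|?M. (norm (P' x e))\<^sup>2)"
    using int[of "\<lambda>x. (norm (P x))\<^sup>2"] int[of "\<lambda>x. (norm (P' x e))\<^sup>2"]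
    by (simp add: continuous_intros c)
  finally show ?thesis by simp
qed

section \<open>Integrability near the origin\<close>

text \<open>Dyadic shells. Where \<open>R / 2 ^ Suc k < norm x \<le> R / 2 ^ k\<close> the integrand
  is at most \<open>a k\<close>, and the enclosing ball has volume \<open>c k\<close>. The products
  form a geometric series of ratio \<open>4 / 2 ^ D\<close>, which is below \<open>1\<close> since
  the dimension exceeds two.\<close>

lemma integrable_inverse_norm_square:
  assumes R: "R > 0" and dim: "DIM('a::euclidean_space) > 2"
  shows "integrable (lebesgue_on (cball (0::'a) R)) (\<lambda>x. 1 / (norm x)\<^sup>2)"
proof -
  define D where "D = DIM('a)"
  define f where "f = (\<lambda>x::'a. indicator (cball 0 R) x *\<^sub>R (1 / (norm x)\<^sup>2))"
  have [measurable]: "f \<in> borel_measurable borel" 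
    unfolding f_def by (intro borel_measurable_scaleR borel_measurable_indicator borel_measurable_divide
        borel_measurable_power borel_measurable_norm) auto
  define a where "a = (\<lambda>k. 4 ^ Suc k / R\<^sup>2)"
  define c where "c = (\<lambda>k. unit_ball_vol (real D) * (R / 2 ^ k) ^ D)"
  have ac_eq: "a k * c k = 4 / R\<^sup>2 * unit_ball_vol (real D) * R ^ D * (4 / 2 ^ D) ^ k" for k
    by (simp add: a_def c_def power_divide power_mult[symmetric] mult.commute[of k])
  have "(2::real) ^ 2 < 2 ^ D" using dim by (intro power_strict_increasing) (auto simp: D_def)
  then have "summable (\<lambda>k. a k * c k)"
    unfolding ac_eq by (intro summable_mult summable_geometric) auto
  moreover have ac_pos: "a k * c k \<ge> 0" for k using R by (simp add: a_def c_def)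
  ultimately have fin: "(\<Sum>k. ennreal (a k * c k)) \<noteq> top"
    by (intro ennreal_suminf_neq_top)
  have single: "F k \<le> (\<Sum>k. F k)" for F :: "nat \<Rightarrow> ennreal" and k
    using sum_le_suminf[OF summableI, of "{k}" F] by simp
  have le: "ennreal (norm (f x)) \<le> (\<Sum>k. ennreal (a k) * indicator (cball 0 (R / 2 ^ k)) x)" for x
  proof (cases "x \<noteq> 0 \<and> norm x \<le> R")
    \<comment> \<open>This includes \<open>x = 0\<close>, where the quotient is \<open>0\<close> by
      convention.\<close>
    case False
    then show ?thesis by (auto simp: f_def)
  next
    case True
    \<comment> \<open>The least such index locates the dyadic shell of \<open>x\<close>; it is
      positive because \<open>norm x \<le> R\<close>, so its predecessor gives the upper
      radius.\<close>
    define P where "P = (\<lambda>n. R / 2 ^ n < norm x)"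
    obtain n where "(1 / 2) ^ n < norm x / R"
      using real_arch_pow_inv[of "norm x / R" "1 / 2"] True R by auto
    then have "P n" using R by (simp add: P_def field_simps power_divide)
    then have P: "P (LEAST n. P n)" by (rule LeastI)
    have "(LEAST n. P n) \<noteq> 0" using P True by (metis P_def div_by_1 not_less power_0)
    then obtain k where k: "(LEAST n. P n) = Suc k" using not0_implies_Suc by blast
    have nk: "norm x \<le> R / 2 ^ k" using not_less_Least[of k P] k by (simp add: P_def not_less)
    have "R / 2 ^ Suc k < norm x" using P k by (simp add: P_def)
    then have "(R / 2 ^ Suc k)\<^sup>2 \<le> (norm x)\<^sup>2" using R by (intro power_mono) auto
    then have "1 / (norm x)\<^sup>2 \<le> 1 / (R / 2 ^ Suc k)\<^sup>2"
      using R by (intro divide_left_mono mult_pos_pos) (use True in auto)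
    also have "\<dots> = a k"
    proof -
      have "((2::real) ^ Suc k)\<^sup>2 = 4 ^ Suc k"
        by (simp only: power_mult[symmetric] mult.commute[of _ 2]) (simp only: power_mult, simp)
      then show ?thesis by (simp only: a_def power_divide) simp
    qed
    finally have "ennreal (norm (f x)) \<le> ennreal (a k) * indicator (cball 0 (R / 2 ^ k)) x"
      using nk True by (auto simp: f_def intro!: ennreal_leI)
    also have "\<dots> \<le> (\<Sum>k. ennreal (a k) * indicator (cball 0 (R / 2 ^ k)) x)"
      by (rule single)
    finally show ?thesis .
  qed
  have "(\<integral>\<^sup>+x. ennreal (norm (f x)) \<partial>lborel) \<le> (\<integral>\<^sup>+x. (\<Sum>k. ennreal (a k) * indicator (cball (0::'a) (R / 2 ^ k)) x) \<partial>lborel)"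
    by (intro nn_integral_mono le)
  also have "\<dots> = (\<Sum>k. \<integral>\<^sup>+x. ennreal (a k) * indicator (cball (0::'a) (R / 2 ^ k)) x \<partial>lborel)"
    by (intro nn_integral_suminf) (auto intro!: borel_measurable_times_ennreal borel_measurable_indicator)
  also have "\<dots> = (\<Sum>k. ennreal (a k * c k))"
  proof (intro suminf_cong)
    fix k
    have "(\<integral>\<^sup>+x. ennreal (a k) * indicator (cball (0::'a) (R / 2 ^ k)) x \<partial>lborel) = ennreal (a k) * ennreal (c k)"
      using R by (simp add: nn_integral_cmult_indicator emeasure_cball c_def D_def)
    also have "\<dots> = ennreal (a k * c k)"
      using R by (intro ennreal_mult[symmetric]) (auto simp: a_def c_def)
    finally show "(\<integral>\<^sup>+x. ennreal (a k) * indicator (cball (0::'a) (R / 2 ^ k)) x \<partial>lborel) = ennreal (a k * c k)" .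
  qed
  finally have "(\<integral>\<^sup>+x. ennreal (norm (f x)) \<partial>lborel) < \<infinity>"
    using fin by (auto simp: less_top)
  then have "integrable lborel f"
    by (intro integrableI_bounded) auto
  then have "integrable lebesgue f"
    by (simp add: integrable_completion)
  then show ?thesis
    unfolding f_def by (subst integrable_restrict_space) auto
qed

text \<open>Stated for arbitrary \<open>f\<close> because the energy density contains
  \<open>deriv\<close>, which is unspecified where the field is not differentiable; the sphere and
  the origin can thus be discarded before anything is known of its measurability.\<close>

lemma LINT_lebesgue_on_diff_negligible:
  fixes f :: "'a::euclidean_space \<Rightarrow> real"
  assumes ST: "T \<subseteq> S" "S \<in> sets lebesgue" "T \<in> sets lebesgue" "negligible (S - T)"
  shows "integral\<^sup>L (lebesgue_on S) f = integral\<^sup>L (lebesgue_on T) f"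
proof -
  let ?f = "\<lambda>S x. indicator S x *\<^sub>R f x"
  have ae: "AE x in lebesgue. ?f S x = ?f T x"
    using ST by (intro AE_I'[of "S - T"]) (auto simp: negligible_iff_null_sets indicator_def)
  have "integral\<^sup>L lebesgue (?f S) = integral\<^sup>L lebesgue (?f T)"
  proof (cases "?f S \<in> borel_measurable lebesgue")
    case True
    show ?thesis
      by (rule integral_cong_AE[OF True borel_measurable_AE[OF True ae] ae])
  next
    \<comment> \<open>Lebesgue measure is complete, so almost-everywhere equality also transfers
      non-measurability, and both integrals take the default value \<open>0\<close>.\<close>
    case False
    have ae': "AE x in lebesgue. ?f T x = ?f S x"
      using ae by eventually_elim (rule sym)
    have "?f T \<notin> borel_measurable lebesgue"
      using False borel_measurable_AE[OF _ ae'] by (rule contrapos_nn)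
    then have "\<not> integrable lebesgue (?f S)" "\<not> integrable lebesgue (?f T)"
      using False borel_measurable_integrable[of lebesgue "?f S"] borel_measurable_integrable[of lebesgue "?f T"] by blast+
    then show ?thesis
      by (metis not_integrable_integral_eq)
  qed
  moreover have "integral\<^sup>L (lebesgue_on V) f = integral\<^sup>L lebesgue (?f V)" if "V \<in> sets lebesgue" for V
    using that by (intro integral_restrict_space) auto
  ultimately show ?thesis
    using ST(2,3) by simp
qed

section \<open>The Frobenius norm\<close>

lemma norm_matrix_sq: "(norm (A :: real^'n^'m))\<^sup>2 = (\<Sum>i\<in>UNIV. \<Sum>j\<in>UNIV. (A $ i $ j)\<^sup>2)"
  unfolding power2_norm_eq_inner inner_vec_def by (simp add: power2_eq_square)

lemma trace_matrix_mult_inner: "trace (A ** B) = A \<bullet> transpose (B :: real^'n^'m)"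
  unfolding trace_def matrix_matrix_mult_def inner_vec_def transpose_def by simp

lemma norm_transpose: "norm (transpose A) = norm (A :: real^'n^'m)"
proof -
  have "(norm (transpose A))\<^sup>2 = (norm A)\<^sup>2"
    unfolding norm_matrix_sq transpose_def vec_lambda_beta by (rule sum.swap)
  then show ?thesis by simp
qed

lemma norm_matrix_mult: "norm (A ** B) \<le> norm (A :: real^'n^'m) * norm (B :: real^'k^'n)"
proof (rule power2_le_imp_le)
  have "(norm (A ** B))\<^sup>2 = (\<Sum>i\<in>UNIV. \<Sum>j\<in>UNIV. (\<Sum>k\<in>UNIV. A $ i $ k * B $ k $ j)\<^sup>2)"
    by (simp add: norm_matrix_sq matrix_matrix_mult_def)
  also have "\<dots> \<le> (\<Sum>i\<in>UNIV. \<Sum>j\<in>UNIV. (\<Sum>k\<in>UNIV. (A $ i $ k)\<^sup>2) * (\<Sum>k\<in>UNIV. (B $ k $ j)\<^sup>2))"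
    by (intro sum_mono Cauchy_Schwarz_ineq_sum)
  also have "\<dots> = (norm A)\<^sup>2 * (\<Sum>j\<in>UNIV. \<Sum>k\<in>UNIV. (B $ k $ j)\<^sup>2)"
    by (simp add: norm_matrix_sq sum_product)
  also have "(\<Sum>j\<in>UNIV. \<Sum>k\<in>UNIV. (B $ k $ j)\<^sup>2) = (norm B)\<^sup>2"
    unfolding norm_matrix_sq by (rule sum.swap)
  finally show "(norm (A ** B))\<^sup>2 \<le> (norm A * norm B)\<^sup>2"
    by (simp add: power_mult_distrib)
qed simp

lemma abs_trace_triple_le:
  "\<bar>trace (A ** B ** C)\<bar> \<le> norm A * norm B * norm (C :: real^'n^'m)"
proof -
  have "\<bar>trace (A ** B ** C)\<bar> \<le> norm (A ** B) * norm C"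
    unfolding trace_matrix_mult_inner using Cauchy_Schwarz_ineq2[of "A ** B" "transpose C"]
    by (simp add: norm_transpose)
  also have "\<dots> \<le> norm A * norm B * norm C"
    by (intro mult_right_mono norm_matrix_mult) auto
  finally show ?thesis .
qed

lemma continuous_on_trace_triple [continuous_intros]:
  fixes A :: "'a::topological_space \<Rightarrow> real^'n^'m" and B :: "'a \<Rightarrow> real^'k^'n" and C :: "'a \<Rightarrow> real^'m^'k"
  assumes "continuous_on S A" "continuous_on S B" "continuous_on S C"
  shows "continuous_on S (\<lambda>x. trace (A x ** B x ** C x))"
  unfolding trace_def matrix_matrix_mult_def using assms by (simp, intro continuous_intros)

lemma trace_triple_add_scaleR:
  fixes A B :: "real^'n^'n" and e :: real
  defines "X \<equiv> A + e *\<^sub>R B"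
  shows "trace (X ** X ** X) = trace (A ** A ** A)
    + e * (trace (A ** A ** B) + trace (A ** B ** A) + trace (B ** A ** A))
    + e\<^sup>2 * (trace (A ** B ** B) + trace (B ** A ** B) + trace (B ** B ** A))
    + e ^ 3 * trace (B ** B ** B)"
proof -
  have tr_scaleR: "trace (c *\<^sub>R M) = c * trace M" for c and M :: "real^'n^'n"
    by (simp add: trace_def sum_distrib_left)
  have add_rdistrib: "(M + M') ** N = M ** N + M' ** N" for M M' N :: "real^'n^'n"
    by (simp add: matrix_matrix_mult_def vec_eq_iff sum.distrib distrib_right)
  have "X ** X ** X = A ** A ** A + e *\<^sub>R (A ** A ** B + A ** B ** A + B ** A ** A)
    + (e\<^sup>2) *\<^sub>R (A ** B ** B + B ** A ** B + B ** B ** A) + (e ^ 3) *\<^sub>R (B ** B ** B)"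
    unfolding X_def
    by (simp add: matrix_add_ldistrib add_rdistrib matrix_scalar_ac scalar_matrix_assoc[symmetric] scaleR_add_right
       power2_eq_square power3_eq_cube)
  then show ?thesis
    by (simp add: trace_add tr_scaleR)
qed

section \<open>The derivative of a hedgehog field\<close>

text \<open>The \<open>k\<close>-th partial derivative of a hedgehog field at \<open>x\<close>, as
  given by the product rule, with the numbers \<open>y\<close> and \<open>g\<close> standing for the
  value and the slope of the profile at \<open>norm x\<close>.\<close>

definition hedgehog_deriv :: "real \<Rightarrow> real \<Rightarrow> real^3 \<Rightarrow> 3 \<Rightarrow> real^3^3" where
  "hedgehog_deriv y g x k = sqrt (3 / 2) *\<^sub>R
     ((g * x $ k / (norm x) ^ 3 - 2 * y * x $ k / (norm x) ^ 4) *\<^sub>R outer x x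
      + (y / (norm x)\<^sup>2) *\<^sub>R (outer (axis k 1) x + outer x (axis k 1))
      - (g * x $ k / (3 * norm x)) *\<^sub>R mat 1)"

lemma norm_outer: "norm (outer x y) = norm x * norm y"
proof -
  have "(norm (outer x y))\<^sup>2 = (norm x * norm y)\<^sup>2"
    unfolding norm_matrix_sq power_mult_distrib power2_norm_eq_inner[of x] power2_norm_eq_inner[of y] inner_vec_def sum_product
    by (simp add: outer_def power2_eq_square mult_ac)
  then show ?thesis by (simp add: power2_eq_iff_nonneg)
qed

lemma norm_mat_1_le: "norm (mat 1 :: real^3^3) \<le> 3"
proof (rule power2_le_imp_le)
  show "(norm (mat 1 :: real^3^3))\<^sup>2 \<le> 3\<^sup>2"
    unfolding norm_matrix_sq by (simp add: mat_def sum_3)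
qed simp

lemma has_real_derivative_norm_line:
  fixes x e :: "'a::real_inner"
  assumes "x \<noteq> 0"
  shows "((\<lambda>s. norm (x + s *\<^sub>R e)) has_real_derivative (x \<bullet> e) / norm x) (at 0)"
proof -
  have "((\<lambda>s. x + s *\<^sub>R e) has_derivative (\<lambda>s. s *\<^sub>R e)) (at 0)"
    by (auto intro!: derivative_eq_intros)
  moreover have "(norm has_derivative (\<lambda>v. v \<bullet> sgn x)) (at (x + 0 *\<^sub>R e))"
    using has_derivative_norm[of x] assms by simp
  ultimately have "(norm \<circ> (\<lambda>s. x + s *\<^sub>R e) has_derivative (\<lambda>v. v \<bullet> sgn x) \<circ> (\<lambda>s. s *\<^sub>R e)) (at 0)"
    by (rule diff_chain_at)
  then show ?thesis
    unfolding has_field_derivative_def o_def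
    by (rule has_derivative_eq_rhs) (simp add: fun_eq_iff sgn_div_norm inner_commute divide_inverse mult_ac)
qed

lemma hedgehog_has_derivative:
  assumes x: "x \<noteq> 0" and h: "(h has_real_derivative g) (at (norm x))"
  shows "((\<lambda>s. hedgehog h (x + s *\<^sub>R axis k 1) $ i $ j) has_real_derivative
    hedgehog_deriv (h (norm x)) g x k $ i $ j) (at 0)"
proof -
  define r where "r = (\<lambda>s. norm (x + s *\<^sub>R axis k 1))"
  define \<delta> where "\<delta> = (mat 1 :: real^3^3) $ i $ j"
  define a where "a = (\<lambda>i. axis k (1::real) $ i)"
  have r0: "r 0 = norm x" "r 0 \<noteq> 0" using x by (auto simp: r_def)
  have r: "(r has_real_derivative x $ k / norm x) (at 0)"
    unfolding r_def using has_real_derivative_norm_line[OF x, of "axis k 1"] by (simp add: inner_axis)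
  have hr: "((\<lambda>s. h (r s)) has_real_derivative g * (x $ k / norm x)) (at 0)"
    by (rule DERIV_chain2[OF _ r]) (use h r0 in simp)
  have eq: "hedgehog h (x + s *\<^sub>R axis k 1) $ i $ j =
      sqrt (3 / 2) * h (r s) * ((x $ i + s * a i) * (x $ j + s * a j) / (r s)\<^sup>2 - \<delta> / 3)" for s
    by (simp add: hedgehog_def outer_def r_def \<delta>_def a_def)
  have "((\<lambda>s. hedgehog h (x + s *\<^sub>R axis k 1) $ i $ j) has_real_derivative
      sqrt (3 / 2) * (g * (x $ k / norm x) * (x $ i * x $ j / (norm x)\<^sup>2 - \<delta> / 3)
       + h (norm x) * ((a i * x $ j + x $ i * a j) / (norm x)\<^sup>2 - 2 * (x $ i * x $ j) * (x $ k / norm x) / (norm x) ^ 3))) (at 0)"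
  proof -
    have N: "((\<lambda>s. (x $ i + s * a i) * (x $ j + s * a j)) has_real_derivative a i * x $ j + x $ i * a j) (at 0)"
      by (auto intro!: derivative_eq_intros simp: algebra_simps)
    have r2: "((\<lambda>s. (r s)\<^sup>2) has_real_derivative 2 * norm x * (x $ k / norm x)) (at 0)"
      using DERIV_power[OF r, of 2] r0 by (simp add: mult_ac)
    have "((\<lambda>s. (x $ i + s * a i) * (x $ j + s * a j) / (r s)\<^sup>2) has_real_derivative
        ((a i * x $ j + x $ i * a j) / (norm x)\<^sup>2 - 2 * (x $ i * x $ j) * (x $ k / norm x) / (norm x) ^ 3)) (at 0)"
      by (rule DERIV_cong[OF DERIV_divide[OF N r2]])
        (use r0 x in \<open>simp_all add: field_simps power2_eq_square power3_eq_cube\<close>)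
    then have "((\<lambda>s. (x $ i + s * a i) * (x $ j + s * a j) / (r s)\<^sup>2 - \<delta> / 3) has_real_derivative
        ((a i * x $ j + x $ i * a j) / (norm x)\<^sup>2 - 2 * (x $ i * x $ j) * (x $ k / norm x) / (norm x) ^ 3)) (at 0)"
      using DERIV_diff[OF _ DERIV_const[of "\<delta> / 3"]] by fastforce
    from DERIV_mult[OF DERIV_cmult[OF hr, of "sqrt (3 / 2)"] this] show ?thesis
      unfolding eq by (rule DERIV_cong) (simp add: r0 algebra_simps)
  qed
  also have "sqrt (3 / 2) * (g * (x $ k / norm x) * (x $ i * x $ j / (norm x)\<^sup>2 - \<delta> / 3)
       + h (norm x) * ((a i * x $ j + x $ i * a j) / (norm x)\<^sup>2 - 2 * (x $ i * x $ j) * (x $ k / norm x) / (norm x) ^ 3))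
      = hedgehog_deriv (h (norm x)) g x k $ i $ j"
    using x by (simp add: hedgehog_deriv_def outer_def \<delta>_def[symmetric] a_def[symmetric])
      (simp add: field_simps power2_eq_square power3_eq_cube power4_eq_xxxx)
  finally show ?thesis .
qed

lemma sqrt_three_halves_le: "sqrt (3 / 2) \<le> 2"
  by (rule real_le_lsqrt) auto

text \<open>Only the order of magnitude matters. The three summands \<open>A\<close>,
  \<open>B\<close>, \<open>C\<close> add up to
  \<open>2 * \<bar>g\<bar> + 4 * (\<bar>y\<bar> / r)\<close>, and the prefactor
  \<open>sqrt (3 / 2)\<close> is rounded up to \<open>2\<close>.\<close>

lemma norm_hedgehog_deriv_le:
  assumes x: "x \<noteq> 0"
  shows "norm (hedgehog_deriv y g x k) \<le> 4 * \<bar>g\<bar> + 8 * (\<bar>y\<bar> / norm x)"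
proof -
  define r where "r = norm x"
  have r: "r > 0" using x by (simp add: r_def)
  have xk: "\<bar>x $ k\<bar> \<le> r" unfolding r_def by (rule component_le_norm_cart)
  define A B C where
    "A = (g * x $ k / r ^ 3 - 2 * y * x $ k / r ^ 4) *\<^sub>R outer x x" and
    "B = (y / r\<^sup>2) *\<^sub>R (outer (axis k 1) x + outer x (axis k 1))" and
    "C = (g * x $ k / (3 * r)) *\<^sub>R (mat 1 :: real^3^3)"
  have "norm A \<le> (\<bar>g\<bar> * r / r ^ 3 + 2 * \<bar>y\<bar> * r / r ^ 4) * r\<^sup>2"
  proof -
    have "\<bar>g * x $ k / r ^ 3 - 2 * y * x $ k / r ^ 4\<bar> \<le> \<bar>g * x $ k / r ^ 3\<bar> + \<bar>2 * y * x $ k / r ^ 4\<bar>"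
      by (rule abs_triangle_ineq4)
    also have "\<dots> \<le> \<bar>g\<bar> * r / r ^ 3 + 2 * \<bar>y\<bar> * r / r ^ 4"
      using r xk by (auto simp: abs_mult intro!: add_mono divide_right_mono mult_left_mono)
    finally have "\<bar>g * x $ k / r ^ 3 - 2 * y * x $ k / r ^ 4\<bar> \<le> \<bar>g\<bar> * r / r ^ 3 + 2 * \<bar>y\<bar> * r / r ^ 4" .
    moreover have "norm (outer x x) = r\<^sup>2" by (simp add: norm_outer r_def power2_eq_square)
    ultimately show ?thesis unfolding A_def norm_scaleR by (metis mult_right_mono zero_le_power2)
  qed
  also have "\<dots> = \<bar>g\<bar> + 2 * (\<bar>y\<bar> / r)"
    using r by (simp add: field_simps power2_eq_square power3_eq_cube power4_eq_xxxx)
  finally have A: "norm A \<le> \<bar>g\<bar> + 2 * (\<bar>y\<bar> / r)" .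
  have "norm B \<le> \<bar>y\<bar> / r\<^sup>2 * (r + r)"
    unfolding B_def norm_scaleR using r
    by (intro mult_mono order_trans[OF norm_triangle_ineq]) (auto simp: norm_outer r_def)
  also have "\<dots> = 2 * (\<bar>y\<bar> / r)" using r by (simp add: field_simps power2_eq_square)
  finally have B: "norm B \<le> 2 * (\<bar>y\<bar> / r)" .
  have "\<bar>g * x $ k / (3 * r)\<bar> = \<bar>g\<bar> * \<bar>x $ k\<bar> / (3 * r)"
    using r by (simp add: abs_mult)
  also have "\<dots> \<le> \<bar>g\<bar> * r / (3 * r)"
    using r xk by (intro divide_right_mono mult_left_mono) auto
  finally have "norm C \<le> (\<bar>g\<bar> * r / (3 * r)) * 3"
    unfolding C_def norm_scaleR using r norm_mat_1_le by (intro mult_mono) auto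
  also have "\<dots> = \<bar>g\<bar>" using r by simp
  finally have C: "norm C \<le> \<bar>g\<bar>" .
  have "norm (A + B - C) \<le> 2 * \<bar>g\<bar> + 4 * (\<bar>y\<bar> / r)"
    using A B C norm_triangle_ineq4[of "A + B" C] norm_triangle_ineq[of A B] by linarith
  then have "sqrt (3 / 2) * norm (A + B - C) \<le> 2 * (2 * \<bar>g\<bar> + 4 * (\<bar>y\<bar> / r))"
    using sqrt_three_halves_le by (intro mult_mono) auto
  then show ?thesis
    by (simp add: hedgehog_deriv_def A_def B_def C_def r_def[symmetric])
qed

lemma norm_hedgehog_le: "norm (hedgehog h x) \<le> 4 * \<bar>h (norm x)\<bar>"
proof -
  have "norm ((1 / (norm x)\<^sup>2) *\<^sub>R outer x x) \<le> 1"
    by (simp add: norm_outer power2_eq_square)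
  moreover have "norm ((1 / 3) *\<^sub>R mat 1 :: real^3^3) \<le> 1"
    using norm_mat_1_le by simp
  ultimately have "norm ((1 / (norm x)\<^sup>2) *\<^sub>R outer x x - (1 / 3) *\<^sub>R mat 1) \<le> 2"
    using norm_triangle_ineq4[of "(1 / (norm x)\<^sup>2) *\<^sub>R outer x x" "(1 / 3) *\<^sub>R mat 1"] by linarith
  then have "norm (hedgehog h x) \<le> (2 * \<bar>h (norm x)\<bar>) * 2"
    unfolding hedgehog_def norm_scaleR using sqrt_three_halves_le
    by (intro mult_mono) (auto simp: abs_mult intro!: mult_right_mono)
  then show ?thesis by simp
qed

lemma continuous_on_outer [continuous_intros]:
  assumes "continuous_on S f" "continuous_on S g"
  shows "continuous_on S (\<lambda>x. outer (f x) (g x))"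
  unfolding outer_def using assms by (intro continuous_intros)

lemma transpose_hedgehog: "transpose (hedgehog h x) = hedgehog h x"
  by (simp add: hedgehog_def transpose_def outer_def vec_eq_iff mat_def mult.commute)

section \<open>The energy along a perturbation\<close>

text \<open>The coefficients of the powers of \<open>\<epsilon>\<close> in the bulk energy density of \<open>A + \<epsilon> B\<close>.\<close>

definition bulk_coeff :: "real \<Rightarrow> nat \<Rightarrow> real^3^3 \<Rightarrow> real^3^3 \<Rightarrow> real" where
  "bulk_coeff t i A B =
     (let \<kappa> = sqrt 6 * h_plus t / t; q = (h_plus t)\<^sup>2 / (2 * t) in
      [- 1 / 2 * (A \<bullet> A) - \<kappa> * trace (A ** A ** A) + q * (A \<bullet> A)\<^sup>2 + bulk_C t,
       - (A \<bullet> B) - \<kappa> * (trace (A ** A ** B) + trace (A ** B ** A) + trace (B ** A ** A)) + 4 * q * ((A \<bullet> A) * (A \<bullet> B)),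
       - 1 / 2 * (B \<bullet> B) - \<kappa> * (trace (A ** B ** B) + trace (B ** A ** B) + trace (B ** B ** A))
         + q * (2 * ((A \<bullet> A) * (B \<bullet> B)) + 4 * (A \<bullet> B)\<^sup>2),
       - \<kappa> * trace (B ** B ** B) + 4 * q * ((A \<bullet> B) * (B \<bullet> B)),
       q * (B \<bullet> B)\<^sup>2] ! i)"

lemma bulk_density_expand:
  fixes A B :: "real^3^3" and \<epsilon> :: real
  assumes "transpose A = A" "transpose B = B"
  defines "X \<equiv> A + \<epsilon> *\<^sub>R B"
  shows "- 1 / 2 * trace (X ** X) - sqrt 6 * h_plus t / t * trace (X ** X ** X)
     + (h_plus t)\<^sup>2 / (2 * t) * (trace (X ** X))\<^sup>2 + bulk_C t = (\<Sum>i\<le>4. \<epsilon> ^ i * bulk_coeff t i A B)"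
proof -
  define \<kappa> q where "\<kappa> = sqrt 6 * h_plus t / t" and "q = (h_plus t)\<^sup>2 / (2 * t)"
  \<comment> \<open>Symmetry turns \<open>trace (X ** X)\<close> into the inner product of
    \<open>X\<close> with itself.\<close>
  have "transpose X = X"
  proof -
    have "transpose (A + \<epsilon> *\<^sub>R B) = transpose A + \<epsilon> *\<^sub>R transpose B"
      by (simp add: transpose_def vec_eq_iff)
    then show ?thesis using assms by simp
  qed
  then have 2: "trace (X ** X) = A \<bullet> A + 2 * \<epsilon> * (A \<bullet> B) + \<epsilon>\<^sup>2 * (B \<bullet> B)"
    unfolding trace_matrix_mult_inner
    by (simp add: X_def inner_add_left inner_add_right inner_commute power2_eq_square algebra_simps)
  have 3: "trace (X ** X ** X) = trace (A ** A ** A)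
    + \<epsilon> * (trace (A ** A ** B) + trace (A ** B ** A) + trace (B ** A ** A))
    + \<epsilon>\<^sup>2 * (trace (A ** B ** B) + trace (B ** A ** B) + trace (B ** B ** A))
    + \<epsilon> ^ 3 * trace (B ** B ** B)"
    unfolding X_def by (rule trace_triple_add_scaleR)
  have *: "- 1 / 2 * (n + 2 * \<epsilon> * b + \<epsilon>\<^sup>2 * c) - k * (t0 + \<epsilon> * t1 + \<epsilon>\<^sup>2 * t2 + \<epsilon> ^ 3 * t3)
     + q * (n + 2 * \<epsilon> * b + \<epsilon>\<^sup>2 * c)\<^sup>2 + C =
     (- 1 / 2 * n - k * t0 + q * n\<^sup>2 + C) + \<epsilon> * (- b - k * t1 + 4 * q * (n * b))
      + \<epsilon>\<^sup>2 * (- 1 / 2 * c - k * t2 + q * (2 * (n * c) + 4 * b\<^sup>2)) + \<epsilon> ^ 3 * (- k * t3 + 4 * q * (b * c))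
      + \<epsilon> ^ 4 * (q * c\<^sup>2)" for n b c k t0 t1 t2 t3 q C :: real
    by algebra
  have "(\<Sum>i\<le>4. \<epsilon> ^ i * bulk_coeff t i A B) = bulk_coeff t 0 A B + \<epsilon> * bulk_coeff t 1 A B
      + \<epsilon>\<^sup>2 * bulk_coeff t 2 A B + \<epsilon> ^ 3 * bulk_coeff t 3 A B + \<epsilon> ^ 4 * bulk_coeff t 4 A B"
    by (simp add: eval_nat_numeral)
  then show ?thesis
    unfolding 2 3 * bulk_coeff_def Let_def by simp
qed

lemma continuous_on_bulk_coeff:
  assumes "continuous_on S A" "continuous_on S B" "i \<le> 4"
  shows "continuous_on S (\<lambda>x. bulk_coeff t i (A x) (B x))"
proof -
  have "i = 0 \<or> i = 1 \<or> i = 2 \<or> i = 3 \<or> i = 4" using assms(3) by auto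
  moreover define \<kappa> q where "\<kappa> = sqrt 6 * h_plus t / t" and "q = (h_plus t)\<^sup>2 / (2 * t)"
  ultimately show ?thesis
    unfolding bulk_coeff_def Let_def \<kappa>_def[symmetric] q_def[symmetric]
    by (elim disjE; simp; intro continuous_intros assms; simp)
qed

text \<open>With \<open>s = |A|\<close> the coefficient is at least
  \<open>(- t - 6 sqrt 6 h\<^sub>+ s + 2 h\<^sub>+\<^sup>2 s\<^sup>2) |B|\<^sup>2 / (2 t)\<close>, and completing the square in \<open>s\<close> makes the
  bound independent of \<open>A\<close>.\<close>

lemma bulk_coeff_2_ge:
  assumes t: "t > 0"
  shows "bulk_coeff t 2 A B \<ge> - 1 / 2 * (1 + 27 / t) * (norm B)\<^sup>2"
proof -
  define s c where "s = norm A" and "c = norm B"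
  define p where "p = h_plus t"
  have p: "p > 0" using t by (simp add: p_def h_plus_def add_pos_nonneg)
  have tr: "\<bar>trace (A ** B ** B)\<bar> \<le> s * c\<^sup>2" "\<bar>trace (B ** A ** B)\<bar> \<le> s * c\<^sup>2" "\<bar>trace (B ** B ** A)\<bar> \<le> s * c\<^sup>2"
    using abs_trace_triple_le[of A B B] abs_trace_triple_le[of B A B] abs_trace_triple_le[of B B A]
    by (simp_all add: s_def c_def power2_eq_square mult_ac)
  have "sqrt 6 * p / t * (trace (A ** B ** B) + trace (B ** A ** B) + trace (B ** B ** A)) \<le> sqrt 6 * p / t * (3 * (s * c\<^sup>2))"
    using tr p t by (intro mult_left_mono) auto
  \<comment> \<open>The square of \<open>A \<bullet> B\<close> has the favourable sign and is
    dropped.\<close>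
  moreover have "p\<^sup>2 / (2 * t) * (2 * (s\<^sup>2 * c\<^sup>2) + 4 * (A \<bullet> B)\<^sup>2) \<ge> p\<^sup>2 / (2 * t) * (2 * (s\<^sup>2 * c\<^sup>2))"
    using t by (intro mult_left_mono) auto
  moreover have "bulk_coeff t 2 A B = - 1 / 2 * c\<^sup>2
      - sqrt 6 * p / t * (trace (A ** B ** B) + trace (B ** A ** B) + trace (B ** B ** A))
      + p\<^sup>2 / (2 * t) * (2 * (s\<^sup>2 * c\<^sup>2) + 4 * (A \<bullet> B)\<^sup>2)"
    by (simp add: bulk_coeff_def Let_def p_def s_def c_def power2_norm_eq_inner)
  \<comment> \<open>The defect of the completed square is
    \<open>(3 / 2 * sqrt 6)\<^sup>2 / t = 27 / (2 * t)\<close>.\<close>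
  moreover have "- 1 / 2 * c\<^sup>2 - sqrt 6 * p / t * (3 * (s * c\<^sup>2)) + p\<^sup>2 / (2 * t) * (2 * (s\<^sup>2 * c\<^sup>2))
      = - 1 / 2 * (1 + 27 / t) * c\<^sup>2 + (p * s - 3 / 2 * sqrt 6)\<^sup>2 / t * c\<^sup>2"
    using t by (simp add: field_simps power2_eq_square)
  moreover have "(p * s - 3 / 2 * sqrt 6)\<^sup>2 / t * c\<^sup>2 \<ge> 0" using t by simp
  ultimately show ?thesis unfolding c_def by linarith
qed

lemma abs_inner_le_if_norm_le:
  assumes "norm a \<le> K / r" "norm b \<le> L / r" "r > 0"
  shows "\<bar>a \<bullet> b\<bar> \<le> K * L / r\<^sup>2"
proof -
  have "\<bar>a \<bullet> b\<bar> \<le> norm a * norm b" by (rule Cauchy_Schwarz_ineq2)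
  also have "\<dots> \<le> (K / r) * (L / r)"
    using assms by (intro mult_mono) (auto intro: order_trans[OF norm_ge_zero])
  finally show ?thesis by (simp add: power2_eq_square)
qed

text \<open>Collects the regularity on which the energy expansion rests: \<open>G\<close> is the
  classical slope of the profile inside the interval, and \<open>P'\<close> the derivative of the
  perturbation.\<close>

locale hedgehog_perturbation =
  fixes t R :: real and h G :: "real \<Rightarrow> real" and K :: real
    and P :: "real^3 \<Rightarrow> real^3^3" and P' :: "real^3 \<Rightarrow> real^3 \<Rightarrow> real^3^3"
  assumes R: "R > 0"
    and h: "continuous_on {0..R} h"
    and G: "continuous_on {0<..<R} G"
    and hG: "\<And>r. r \<in> {0<..<R} \<Longrightarrow> (h has_real_derivative G r) (at r)"
    and GK: "\<And>r. r \<in> {0<..<R} \<Longrightarrow> \<bar>G r\<bar> \<le> K / r"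
    and P: "\<And>x. x \<in> cball 0 R \<Longrightarrow> (P has_derivative P' x) (at x)"
    and P': "\<And>v. v \<in> Basis \<Longrightarrow> continuous_on (cball 0 R) (\<lambda>x. P' x v)"
    and P_sym: "\<And>x. x \<in> cball 0 R \<Longrightarrow> P x \<in> sym_traceless"
begin

text \<open>The part of the ball where the hedgehog is classically differentiable: its formula is
  singular at the origin, and the slope of the profile is known only for radii below
  \<open>R\<close>.\<close>

definition "\<Omega> = ball (0 :: real^3) R - {0}"
definition "dQ k x = hedgehog_deriv (h (norm x)) (G (norm x)) x k"
definition "dP k x = P' x (axis k 1)"

lemma \<Omega>D: "x \<in> \<Omega> \<Longrightarrow> x \<in> cball 0 R" "x \<in> \<Omega> \<Longrightarrow> x \<noteq> 0" "x \<in> \<Omega> \<Longrightarrow> norm x \<in> {0<..<R}"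
  by (auto simp: \<Omega>_def)

lemma \<Omega>_subset: "\<Omega> \<subseteq> cball 0 R" by (auto simp: \<Omega>_def)

lemma \<Omega>_sets [simp]: "\<Omega> \<in> sets lebesgue" by (auto simp: \<Omega>_def)

lemma LINT_cball: "(LINT x|lebesgue_on (cball 0 R). f x) = (LINT x|lebesgue_on \<Omega>. f x)" for f :: "real^3 \<Rightarrow> real"
proof (rule LINT_lebesgue_on_diff_negligible[OF \<Omega>_subset])
  have "cball 0 R - \<Omega> \<subseteq> insert 0 (sphere (0::real^3) R)" by (auto simp: \<Omega>_def)
  then show "negligible (cball 0 R - \<Omega>)"
    by (rule negligible_subset[rotated]) (simp add: negligible_sphere)
qed auto

lemma continuous_on_P: "continuous_on (cball 0 R) P"
  using P by (auto intro!: continuous_at_imp_continuous_on has_derivative_continuous)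

lemma continuous_on_dP: "continuous_on (cball 0 R) (dP k)"
  unfolding dP_def by (rule P') (auto simp: axis_in_Basis_iff)

lemma continuous_on_norm_compose:
  "continuous_on \<Omega> (\<lambda>x. h (norm x))" "continuous_on \<Omega> (\<lambda>x. G (norm x))"
  by (rule continuous_on_compose2[OF h] continuous_on_compose2[OF G];
      use \<Omega>D(3) in \<open>force intro!: continuous_intros\<close>)+

lemma continuous_on_hedgehog: "continuous_on \<Omega> (hedgehog h)"
  unfolding hedgehog_def by (intro continuous_intros continuous_on_norm_compose) (auto simp: \<Omega>_def)

lemma continuous_on_dQ: "continuous_on \<Omega> (dQ k)"
  unfolding dQ_def hedgehog_deriv_def
  by (intro continuous_intros continuous_on_norm_compose) (auto simp: \<Omega>_def)

lemma integrable_on_\<Omega>: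
  assumes "continuous_on \<Omega> f" "\<And>x. x \<in> \<Omega> \<Longrightarrow> \<bar>f x\<bar> \<le> L / (norm x)\<^sup>2"
  shows "integrable (lebesgue_on \<Omega>) f"
proof (rule Bochner_Integration.integrable_bound[where f = "\<lambda>x. L * (1 / (norm x)\<^sup>2)"])
  have "integrable (lebesgue_on (cball (0::real^3) R)) (\<lambda>x. 1 / (norm x)\<^sup>2)"
    by (rule integrable_inverse_norm_square[OF R]) simp
  then have "integrable lebesgue (\<lambda>x::real^3. indicator (cball 0 R) x *\<^sub>R (1 / (norm x)\<^sup>2))"
    by (subst (asm) integrable_restrict_space) auto
  then have "integrable lebesgue (\<lambda>x. indicator \<Omega> x *\<^sub>R (indicator (cball 0 R) x *\<^sub>R (1 / (norm x)\<^sup>2)))"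
    by (rule Bochner_Integration.integrable_mult_indicator[rotated]) simp
  also have "(\<lambda>x. indicator \<Omega> x *\<^sub>R (indicator (cball 0 R) x *\<^sub>R (1 / (norm x)\<^sup>2))) =
      (\<lambda>x. indicator \<Omega> x *\<^sub>R (1 / (norm x)\<^sup>2))"
    using \<Omega>_subset by (auto simp: indicator_def fun_eq_iff)
  finally have "integrable (lebesgue_on \<Omega>) (\<lambda>x. 1 / (norm x)\<^sup>2)"
    by (subst integrable_restrict_space) auto
  then show "integrable (lebesgue_on \<Omega>) (\<lambda>x. L * (1 / (norm x)\<^sup>2))"
    by (rule Bochner_Integration.integrable_mult_right)
  show "f \<in> borel_measurable (lebesgue_on \<Omega>)"
    using assms(1) by (rule continuous_imp_measurable_on_sets_lebesgue) simp
  show "AE x in lebesgue_on \<Omega>. norm (f x) \<le> norm (L * (1 / (norm x)\<^sup>2))"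
  proof (intro AE_I2)
    fix x assume "x \<in> space (lebesgue_on \<Omega>)"
    then have "\<bar>f x\<bar> \<le> L / (norm x)\<^sup>2" using assms(2) by simp
    also have "\<dots> \<le> \<bar>L / (norm x)\<^sup>2\<bar>" by (rule abs_ge_self)
    finally show "norm (f x) \<le> norm (L * (1 / (norm x)\<^sup>2))" by simp
  qed
qed

lemma bounded_cball:
  fixes f :: "real^3 \<Rightarrow> 'b::real_normed_vector"
  assumes "continuous_on (cball 0 R) f"
  obtains B where "B \<ge> 0" "\<And>x. x \<in> cball 0 R \<Longrightarrow> norm (f x) \<le> B"
proof -
  have "bounded (f ` cball 0 R)"
    using assms by (intro compact_imp_bounded compact_continuous_image) auto
  then obtain B where "\<forall>y\<in>f ` cball 0 R. norm y \<le> B"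
    unfolding bounded_iff by blast
  then show thesis by (intro that[of "max 0 B"]) (auto simp: le_max_iff_disj)
qed

lemma h_bounded:
  obtains M where "M \<ge> 0" "\<And>x. x \<in> \<Omega> \<Longrightarrow> \<bar>h (norm x)\<bar> \<le> M"
proof -
  have "continuous_on (cball 0 R) (\<lambda>x::real^3. h (norm x))"
    by (rule continuous_on_compose2[OF h]) (auto intro!: continuous_intros)
  then obtain M where "M \<ge> 0" "\<And>x::real^3. x \<in> cball 0 R \<Longrightarrow> norm (h (norm x)) \<le> M"
    by (rule bounded_cball) blast
  then show thesis using that \<Omega>_subset by (metis real_norm_def subsetD)
qed

lemma dQ_bound: obtains L where "\<And>k x. x \<in> \<Omega> \<Longrightarrow> norm (dQ k x) \<le> L / norm x"
proof -
  obtain M where M: "M \<ge> 0" "\<And>x. x \<in> \<Omega> \<Longrightarrow> \<bar>h (norm x)\<bar> \<le> M"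
    by (rule h_bounded) blast
  show thesis
  proof (rule that[of "4 * K + 8 * M"])
    fix k x assume x: "x \<in> \<Omega>"
    have "norm (dQ k x) \<le> 4 * \<bar>G (norm x)\<bar> + 8 * (\<bar>h (norm x)\<bar> / norm x)"
      unfolding dQ_def using \<Omega>D(2)[OF x] by (rule norm_hedgehog_deriv_le)
    also have "\<dots> \<le> 4 * (K / norm x) + 8 * (M / norm x)"
      using GK[OF \<Omega>D(3)[OF x]] M(2)[OF x] by (intro add_mono mult_left_mono divide_right_mono) auto
    finally show "norm (dQ k x) \<le> (4 * K + 8 * M) / norm x"
      by (simp add: add_divide_distrib)
  qed
qed

text \<open>\<open>dP\<close> is even bounded, but the weaker form \<open>L / norm x\<close> matches
  \<open>dQ_bound\<close>, so that all gradient products obey one estimate of order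
  \<open>1 / (norm x)\<^sup>2\<close>.\<close>

lemma dP_bound: obtains L where "\<And>x. x \<in> \<Omega> \<Longrightarrow> norm (dP k x) \<le> L / norm x"
proof -
  obtain B where B: "B \<ge> 0" "\<And>x. x \<in> cball 0 R \<Longrightarrow> norm (dP k x) \<le> B"
    by (rule bounded_cball[OF continuous_on_dP[of k]]) blast
  show thesis
  proof (rule that[of "B * R"])
    fix x assume x: "x \<in> \<Omega>"
    have "norm (dP k x) * norm x \<le> B * R"
      using B(1) B(2)[OF \<Omega>D(1)[OF x]] \<Omega>D(3)[OF x] by (intro mult_mono) auto
    then show "norm (dP k x) \<le> B * R / norm x" using \<Omega>D(3)[OF x] by (simp add: field_simps)
  qed
qed

lemma integrable_grad_inner:
  "integrable (lebesgue_on \<Omega>) (\<lambda>x. dQ k x \<bullet> dQ k x)"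
  "integrable (lebesgue_on \<Omega>) (\<lambda>x. dQ k x \<bullet> dP k x)"
  "integrable (lebesgue_on \<Omega>) (\<lambda>x. dP k x \<bullet> dP k x)"
proof -
  obtain L where L: "\<And>k x. x \<in> \<Omega> \<Longrightarrow> norm (dQ k x) \<le> L / norm x" by (rule dQ_bound) blast
  obtain L' where L': "\<And>x. x \<in> \<Omega> \<Longrightarrow> norm (dP k x) \<le> L' / norm x" by (rule dP_bound) blast
  note c = continuous_on_dQ[of k] continuous_on_subset[OF continuous_on_dP[of k] \<Omega>_subset]
  show "integrable (lebesgue_on \<Omega>) (\<lambda>x. dQ k x \<bullet> dQ k x)"
    by (rule integrable_on_\<Omega>[OF continuous_on_inner[OF c(1) c(1)] abs_inner_le_if_norm_le[OF L L]])
      (auto simp: \<Omega>_def)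
  show "integrable (lebesgue_on \<Omega>) (\<lambda>x. dQ k x \<bullet> dP k x)"
    by (rule integrable_on_\<Omega>[OF continuous_on_inner[OF c(1) c(2)] abs_inner_le_if_norm_le[OF L L']])
      (auto simp: \<Omega>_def)
  show "integrable (lebesgue_on \<Omega>) (\<lambda>x. dP k x \<bullet> dP k x)"
    by (rule integrable_on_\<Omega>[OF continuous_on_inner[OF c(2) c(2)] abs_inner_le_if_norm_le[OF L' L']])
      (auto simp: \<Omega>_def)
qed

lemma integrable_bulk_coeff:
  assumes i: "i \<le> 4"
  shows "integrable (lebesgue_on \<Omega>) (\<lambda>x. bulk_coeff t i (hedgehog h x) (P x))"
proof -
  obtain M where M: "M \<ge> 0" "\<And>x. x \<in> \<Omega> \<Longrightarrow> \<bar>h (norm x)\<bar> \<le> M"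
    by (rule h_bounded) blast
  obtain B where B: "B \<ge> 0" "\<And>x. x \<in> cball 0 R \<Longrightarrow> norm (P x) \<le> B"
    by (rule bounded_cball[OF continuous_on_P]) blast
  \<comment> \<open>The hedgehog is bounded but need not be continuous at the origin, so compactness
    is used in the space of matrix pairs rather than on the ball.\<close>
  define S where "S = cball (0::real^3^3) (4 * M) \<times> cball (0::real^3^3) B"
  have "compact ((\<lambda>z. bulk_coeff t i (fst z) (snd z)) ` S)"
    by (intro compact_continuous_image continuous_on_bulk_coeff i continuous_intros)
      (auto simp: S_def compact_Times)
  then have "bounded ((\<lambda>z. bulk_coeff t i (fst z) (snd z)) ` S)"
    by (rule compact_imp_bounded)
  then obtain C where C: "\<forall>y \<in> (\<lambda>z. bulk_coeff t i (fst z) (snd z)) ` S. norm y \<le> C"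
    unfolding bounded_iff by blast
  show ?thesis
  proof (rule integrable_on_\<Omega>[where L = "C * R\<^sup>2"])
    show "continuous_on \<Omega> (\<lambda>x. bulk_coeff t i (hedgehog h x) (P x))"
      by (intro continuous_on_bulk_coeff continuous_on_hedgehog continuous_on_subset[OF continuous_on_P \<Omega>_subset] i)
    fix x assume x: "x \<in> \<Omega>"
    have "norm (hedgehog h x) \<le> 4 * M"
      using norm_hedgehog_le[of h x] M(2)[OF x] by simp
    then have "(hedgehog h x, P x) \<in> S"
      using B(2)[OF \<Omega>D(1)[OF x]] by (simp add: S_def)
    then have C': "\<bar>bulk_coeff t i (hedgehog h x) (P x)\<bar> \<le> C"
      using C by force
    have "(norm x)\<^sup>2 \<le> R\<^sup>2" using \<Omega>D(3)[OF x] by (intro power_mono) auto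
    then have "\<bar>bulk_coeff t i (hedgehog h x) (P x)\<bar> * (norm x)\<^sup>2 \<le> C * R\<^sup>2"
      using C' by (intro mult_mono) auto
    then show "\<bar>bulk_coeff t i (hedgehog h x) (P x)\<bar> \<le> C * R\<^sup>2 / (norm x)\<^sup>2"
      using \<Omega>D(2)[OF x] by (simp add: field_simps)
  qed
qed

lemma partial_deriv_perturbed:
  assumes x: "x \<in> \<Omega>"
  shows "partial_deriv k (\<lambda>y. (hedgehog h y + \<epsilon> *\<^sub>R P y) $ i $ j) x = (dQ k x + \<epsilon> *\<^sub>R dP k x) $ i $ j"
proof -
  have Q: "((\<lambda>s. hedgehog h (x + s *\<^sub>R axis k 1) $ i $ j) has_real_derivative dQ k x $ i $ j) (at 0)"
    unfolding dQ_def by (rule hedgehog_has_derivative[OF \<Omega>D(2)[OF x] hG[OF \<Omega>D(3)[OF x]]])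
  have Px: "(P has_derivative P' x) (at (x + 0 *\<^sub>R axis k 1))"
    using P[OF \<Omega>D(1)[OF x]] by simp
  interpret linear "P' x" using Px by (rule has_derivative_linear)
  have "((\<lambda>s. x + s *\<^sub>R axis k 1) has_derivative (\<lambda>s. s *\<^sub>R axis k 1)) (at 0)"
    by (auto intro!: derivative_eq_intros)
  from diff_chain_at[OF this Px]
  have "((\<lambda>s. P (x + s *\<^sub>R axis k 1)) has_derivative (\<lambda>s. s *\<^sub>R dP k x)) (at 0)"
    by (simp add: o_def scaleR dP_def)
  from bounded_linear.has_derivative[OF bounded_linear_vec_nth this, of i]
  have "((\<lambda>s. P (x + s *\<^sub>R axis k 1) $ i) has_derivative (\<lambda>s. (s *\<^sub>R dP k x) $ i)) (at 0)" .
  from bounded_linear.has_derivative[OF bounded_linear_vec_nth this, of j]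
  have P2: "((\<lambda>s. P (x + s *\<^sub>R axis k 1) $ i $ j) has_real_derivative dP k x $ i $ j) (at 0)"
    unfolding has_field_derivative_def by (rule has_derivative_eq_rhs) (simp add: fun_eq_iff)
  have "((\<lambda>s. (hedgehog h (x + s *\<^sub>R axis k 1) + \<epsilon> *\<^sub>R P (x + s *\<^sub>R axis k 1)) $ i $ j)
      has_real_derivative (dQ k x + \<epsilon> *\<^sub>R dP k x) $ i $ j) (at 0)"
    using DERIV_add[OF Q DERIV_cmult[OF P2, of \<epsilon>]] by simp
  then show ?thesis
    unfolding partial_deriv_def by (rule DERIV_imp_deriv)
qed

text \<open>The gradient part is quadratic in \<open>\<epsilon>\<close>; the zeros pad it to the
  same index range as \<open>bulk_coeff\<close>.\<close>

definition grad_coeff :: "nat \<Rightarrow> real^3 \<Rightarrow> real" where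
  "grad_coeff i x = [1 / 2 * (\<Sum>k\<in>UNIV. dQ k x \<bullet> dQ k x), \<Sum>k\<in>UNIV. dQ k x \<bullet> dP k x,
     1 / 2 * (\<Sum>k\<in>UNIV. dP k x \<bullet> dP k x), 0, 0] ! i"

lemma grad_sq_perturbed:
  assumes x: "x \<in> \<Omega>"
  shows "1 / 2 * grad_sq (\<lambda>y. hedgehog h y + \<epsilon> *\<^sub>R P y) x = (\<Sum>i\<le>4. \<epsilon> ^ i * grad_coeff i x)"
proof -
  have "grad_sq (\<lambda>y. hedgehog h y + \<epsilon> *\<^sub>R P y) x =
      (\<Sum>i\<in>UNIV. \<Sum>j\<in>UNIV. \<Sum>k\<in>UNIV. ((dQ k x + \<epsilon> *\<^sub>R dP k x) $ i $ j)\<^sup>2)"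
    unfolding grad_sq_def partial_deriv_perturbed[OF x] ..
  also have "\<dots> = (\<Sum>i\<in>UNIV. \<Sum>k\<in>UNIV. \<Sum>j\<in>UNIV. ((dQ k x + \<epsilon> *\<^sub>R dP k x) $ i $ j)\<^sup>2)"
    by (rule sum.cong[OF refl]) (rule sum.swap)
  also have "\<dots> = (\<Sum>k\<in>UNIV. (norm (dQ k x + \<epsilon> *\<^sub>R dP k x))\<^sup>2)"
    unfolding norm_matrix_sq by (rule sum.swap)
  also have "\<dots> = (\<Sum>k\<in>UNIV. dQ k x \<bullet> dQ k x + 2 * \<epsilon> * (dQ k x \<bullet> dP k x) + \<epsilon>\<^sup>2 * (dP k x \<bullet> dP k x))"
    unfolding power2_norm_eq_inner
    by (simp add: inner_add_left inner_add_right inner_commute power2_eq_square algebra_simps)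
  also have "\<dots> = (\<Sum>k\<in>UNIV. dQ k x \<bullet> dQ k x) + 2 * \<epsilon> * (\<Sum>k\<in>UNIV. dQ k x \<bullet> dP k x) + \<epsilon>\<^sup>2 * (\<Sum>k\<in>UNIV. dP k x \<bullet> dP k x)"
    by (simp add: sum.distrib sum_distrib_left)
  finally show ?thesis
    by (simp add: eval_nat_numeral grad_coeff_def nth_Cons' algebra_simps)
qed

definition energy_coeff :: "nat \<Rightarrow> real" where
  "energy_coeff i = (LINT x|lebesgue_on \<Omega>. grad_coeff i x + bulk_coeff t i (hedgehog h x) (P x))"

lemma integrable_grad_coeff:
  assumes "i \<le> 4"
  shows "integrable (lebesgue_on \<Omega>) (grad_coeff i)"
proof -
  have "i = 0 \<or> i = 1 \<or> i = 2 \<or> i = 3 \<or> i = 4" using assms by auto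
  then show ?thesis
    unfolding grad_coeff_def
    by (elim disjE; simp; intro integrable_divide Bochner_Integration.integrable_sum integrable_grad_inner)
qed

lemma LG_energy_perturbed:
  "LG_energy t R (\<lambda>x. hedgehog h x + \<epsilon> *\<^sub>R P x) = (\<Sum>i\<le>4. \<epsilon> ^ i * energy_coeff i)"
proof -
  let ?X = "\<lambda>x. hedgehog h x + \<epsilon> *\<^sub>R P x"
  have "LG_energy t R ?X = (LINT x|lebesgue_on \<Omega>. (\<Sum>i\<le>4. \<epsilon> ^ i * (grad_coeff i x + bulk_coeff t i (hedgehog h x) (P x))))"
    unfolding LG_energy_def LINT_cball
  proof (rule Bochner_Integration.integral_cong[OF refl])
    fix x assume "x \<in> space (lebesgue_on \<Omega>)"
    then have x: "x \<in> \<Omega>" by simp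
    have "transpose (P x) = P x"
      using P_sym[OF \<Omega>D(1)[OF x]] by (simp add: sym_traceless_def)
    from bulk_density_expand[OF transpose_hedgehog[of h x] this, where \<epsilon> = \<epsilon> and t = t] grad_sq_perturbed[OF x, of \<epsilon>]
    show "1 / 2 * grad_sq ?X x - 1 / 2 * trace (?X x ** ?X x) - sqrt 6 * h_plus t / t * trace (?X x ** ?X x ** ?X x)
        + (h_plus t)\<^sup>2 / (2 * t) * (trace (?X x ** ?X x))\<^sup>2 + bulk_C t
      = (\<Sum>i\<le>4. \<epsilon> ^ i * (grad_coeff i x + bulk_coeff t i (hedgehog h x) (P x)))"
      by (simp add: distrib_left sum.distrib)
  qed
  also have "\<dots> = (\<Sum>i\<le>4. \<epsilon> ^ i * energy_coeff i)"
    unfolding energy_coeff_def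
    by (rule integrable_sum_atMost4) (intro Bochner_Integration.integrable_add integrable_grad_coeff integrable_bulk_coeff)
  finally show ?thesis .
qed

text \<open>The energy is a polynomial in \<open>\<epsilon>\<close>, so both differentiability
  requirements hold and the second derivative at \<open>0\<close> is twice the quadratic
  coefficient.\<close>

lemma second_variation_pos_iff:
  "second_variation_pos t R (hedgehog h) P \<longleftrightarrow> energy_coeff 2 > 0"
proof -
  define E where "E = (\<lambda>\<epsilon>. LG_energy t R (\<lambda>x. hedgehog h x + \<epsilon> *\<^sub>R P x))"
  have E: "E = (\<lambda>\<epsilon>. energy_coeff 0 + \<epsilon> * energy_coeff 1 + \<epsilon>\<^sup>2 * energy_coeff 2 + \<epsilon> ^ 3 * energy_coeff 3 + \<epsilon> ^ 4 * energy_coeff 4)"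
    unfolding E_def LG_energy_perturbed by (simp add: eval_nat_numeral)
  have 1: "(E has_real_derivative energy_coeff 1 + 2 * \<epsilon> * energy_coeff 2 + 3 * \<epsilon>\<^sup>2 * energy_coeff 3 + 4 * \<epsilon> ^ 3 * energy_coeff 4) (at \<epsilon>)" for \<epsilon>
    unfolding E by (auto intro!: derivative_eq_intros simp: algebra_simps)
  then have E': "deriv E = (\<lambda>\<epsilon>. energy_coeff 1 + 2 * \<epsilon> * energy_coeff 2 + 3 * \<epsilon>\<^sup>2 * energy_coeff 3 + 4 * \<epsilon> ^ 3 * energy_coeff 4)"
    by (intro ext DERIV_imp_deriv)
  have 2: "(deriv E has_real_derivative 2 * energy_coeff 2) (at 0)"
    unfolding E' by (auto intro!: derivative_eq_intros)
  have "\<forall>\<^sub>F \<epsilon> in nhds 0. E field_differentiable (at \<epsilon>)"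
    using 1 by (intro always_eventually) (auto simp: field_differentiable_def)
  moreover have "deriv E field_differentiable (at 0)"
    using 2 by (auto simp: field_differentiable_def)
  ultimately show ?thesis
    unfolding second_variation_pos_def Let_def E_def[symmetric] using DERIV_imp_deriv[OF 2] by simp
qed

text \<open>Adding the Poincare inequalities of the three axes improves the constant for the full
  gradient from \<open>4 * R\<^sup>2\<close> to a third of it. Strictness comes from
  \<open>J > 0\<close>.\<close>

lemma energy_coeff_2_pos:
  assumes t: "t > 0" and small: "4 * R\<^sup>2 * (1 + 27 / t) < 3"
    and P0: "\<And>x. x \<in> sphere 0 R \<Longrightarrow> P x = 0" and nz: "\<exists>x\<in>cball 0 R. P x \<noteq> 0"
  shows "energy_coeff 2 > 0"
proof -
  let ?M = "lebesgue_on \<Omega>"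
  define J where "J = (LINT x|?M. (norm (P x))\<^sup>2)"
  have intc: "integrable (lebesgue_on (cball 0 R)) (\<lambda>x. (norm (P x))\<^sup>2)"
    by (intro compact_continuous_imp_integrable continuous_intros continuous_on_P) auto
  have intP: "integrable ?M (\<lambda>x. (norm (P x))\<^sup>2)"
  proof -
    obtain B where B: "B \<ge> 0" "\<And>x. x \<in> cball 0 R \<Longrightarrow> norm (P x) \<le> B"
      by (rule bounded_cball[OF continuous_on_P]) blast
    show ?thesis
    proof (rule integrable_on_\<Omega>)
      show "continuous_on \<Omega> (\<lambda>x. (norm (P x))\<^sup>2)"
        by (intro continuous_intros continuous_on_subset[OF continuous_on_P \<Omega>_subset])
      fix x assume x: "x \<in> \<Omega>"
      have "(norm (P x))\<^sup>2 * (norm x)\<^sup>2 \<le> B\<^sup>2 * R\<^sup>2"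
        using B(2)[OF \<Omega>D(1)[OF x]] \<Omega>D(3)[OF x] by (intro mult_mono power_mono) auto
      then show "\<bar>(norm (P x))\<^sup>2\<bar> \<le> B\<^sup>2 * R\<^sup>2 / (norm x)\<^sup>2" using \<Omega>D(2)[OF x] by (simp add: field_simps)
    qed
  qed
  have J_pos: "J > 0"
  proof -
    have "J \<ge> 0" unfolding J_def by (rule Bochner_Integration.integral_nonneg) simp
    moreover have "J \<noteq> 0"
    proof
      assume "J = 0"
      then have "integral (cball 0 R) (\<lambda>x. (norm (P x))\<^sup>2) = 0"
        using lebesgue_integral_eq_integral[OF intc] by (simp add: J_def LINT_cball)
      \<comment> \<open>The vanishing criterion for continuous nonnegative integrands is applied on
        the closure of an open set, so a nonzero value of \<open>P\<close> on the closed ball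
        contradicts it.\<close>
      then have "((\<lambda>x. (norm (P x))\<^sup>2) has_integral 0) (closure (ball 0 R))"
        using integrable_on_lebesgue_on[OF intc] R by (metis closure_ball has_integral_integrable_integral lmeasurable_cball fmeasurableD not_less_iff_gr_or_eq)
      moreover obtain x where x: "x \<in> cball 0 R" "P x \<noteq> 0" using nz by blast
      ultimately have "(norm (P x))\<^sup>2 = 0"
        by (intro has_integral_0_closure_imp_0[of "ball 0 R" "\<lambda>x. (norm (P x))\<^sup>2"])
          (use R in \<open>auto intro!: continuous_intros continuous_on_P simp: emeasure_ball emeasure_cball\<close>)
      then show False using x by simp
    qed
    ultimately show ?thesis by simp
  qed
  have poincare: "J \<le> 4 * R\<^sup>2 * (LINT x|?M. dP k x \<bullet> dP k x)" for k
    using Poincare_cball[OF R P P' P0, of "axis k 1"] unfolding LINT_cball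
    by (simp add: J_def dP_def axis_in_Basis_iff power2_norm_eq_inner)
  have "energy_coeff 2 \<ge> (LINT x|?M. 1 / 2 * (\<Sum>k\<in>UNIV. dP k x \<bullet> dP k x) - 1 / 2 * (1 + 27 / t) * (norm (P x))\<^sup>2)"
    unfolding energy_coeff_def
  proof (rule integral_mono)
    show "integrable ?M (\<lambda>x. 1 / 2 * (\<Sum>k\<in>UNIV. dP k x \<bullet> dP k x) - 1 / 2 * (1 + 27 / t) * (norm (P x))\<^sup>2)"
      by (intro Bochner_Integration.integrable_diff integrable_mult_right Bochner_Integration.integrable_sum integrable_grad_inner intP)
    show "integrable ?M (\<lambda>x. grad_coeff 2 x + bulk_coeff t 2 (hedgehog h x) (P x))"
      by (intro Bochner_Integration.integrable_add integrable_grad_coeff integrable_bulk_coeff) auto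
    fix x
    show "1 / 2 * (\<Sum>k\<in>UNIV. dP k x \<bullet> dP k x) - 1 / 2 * (1 + 27 / t) * (norm (P x))\<^sup>2
      \<le> grad_coeff 2 x + bulk_coeff t 2 (hedgehog h x) (P x)"
      using bulk_coeff_2_ge[OF t, where A = "hedgehog h x" and B = "P x"] by (simp add: grad_coeff_def)
  qed
  also have "(LINT x|?M. 1 / 2 * (\<Sum>k\<in>UNIV. dP k x \<bullet> dP k x) - 1 / 2 * (1 + 27 / t) * (norm (P x))\<^sup>2) =
      1 / 2 * (\<Sum>k\<in>UNIV. (LINT x|?M. dP k x \<bullet> dP k x)) - 1 / 2 * (1 + 27 / t) * J"
    unfolding J_def using integrable_grad_inner(3) intP
    by (simp add: Bochner_Integration.integrable_sum)
  finally have "energy_coeff 2 \<ge> 1 / 2 * (\<Sum>k\<in>UNIV. (LINT x|?M. dP k x \<bullet> dP k x)) - 1 / 2 * (1 + 27 / t) * J" .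
  moreover have "3 * J \<le> 4 * R\<^sup>2 * (\<Sum>k\<in>UNIV. (LINT x|?M. dP k x \<bullet> dP k x))"
    using poincare[of 1] poincare[of 2] poincare[of 3] by (simp add: sum_3 distrib_left)
  moreover have "4 * R\<^sup>2 * (1 + 27 / t) * J < 3 * J"
    using small J_pos by (rule mult_strict_right_mono)
  ultimately have "4 * R\<^sup>2 * ((\<Sum>k\<in>UNIV. (LINT x|?M. dP k x \<bullet> dP k x)) - (1 + 27 / t) * J) > 0"
    and *: "energy_coeff 2 \<ge> 1 / 2 * ((\<Sum>k\<in>UNIV. (LINT x|?M. dP k x \<bullet> dP k x)) - (1 + 27 / t) * J)"
    by (simp_all add: algebra_simps)
  then have "(\<Sum>k\<in>UNIV. (LINT x|?M. dP k x \<bullet> dP k x)) - (1 + 27 / t) * J > 0"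
    using R by (simp add: zero_less_mult_iff)
  then show ?thesis
    by (intro less_le_trans[OF mult_pos_pos *]) simp_all
qed

end

section \<open>From the radius condition to the stability theorem\<close>

lemma radius_condition_imp:
  assumes t: "t > 1" and R: "R\<^sup>2 < 1 / 4 * (1 / (1 + 4 * sqrt 6 * h_plus t / t))"
  shows "4 * R\<^sup>2 * (1 + 27 / t) < 3"
proof -
  define c where "c = 1 + 4 * sqrt 6 * h_plus t / t"
  have hp: "h_plus t \<ge> 3 / 2"
  proof -
    have "sqrt (9 + 8 * t) \<ge> 3" using t by (intro real_le_rsqrt) auto
    then show ?thesis by (simp add: h_plus_def)
  qed
  have "sqrt 6 \<ge> 2" by (intro real_le_rsqrt) auto
  then have "sqrt 6 * h_plus t \<ge> 2 * (3 / 2)" using hp by (intro mult_mono) auto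
  \<comment> \<open>Nine is enough because the three directions contribute a factor three:
    \<open>27 = 3 * 9\<close>. The bounds on \<open>sqrt 6\<close> and \<open>h_plus t\<close> even
    give \<open>12\<close>; strictness in the next steps comes from \<open>1 < 3\<close>.\<close>
  then have "9 \<le> 4 * sqrt 6 * h_plus t" by simp
  then have "9 / t \<le> 4 * sqrt 6 * h_plus t / t" using t by (intro divide_right_mono) auto
  then have c: "1 + 27 / t < 3 * c" by (simp add: c_def)
  have c0: "c > 0" using t hp by (simp add: c_def add_pos_nonneg)
  have "4 * R\<^sup>2 * c < 1" using mult_strict_right_mono[OF R[folded c_def] c0] c0 by simp
  moreover have "4 * R\<^sup>2 * (1 + 27 / t) \<le> 4 * R\<^sup>2 * (3 * c)"
    using c by (intro mult_left_mono) auto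
  ultimately show ?thesis by linarith
qed

lemma LG_stable_hedgehog:
  assumes t: "t > 1" and R: "R > 0"
    and small: "R\<^sup>2 < 1 / 4 * (1 / (1 + 4 * sqrt 6 * h_plus t / t))"
    and min: "radial_minimizer t R h"
  shows "LG_stable t R (hedgehog h)"
  unfolding LG_stable_def
proof (intro allI impI, elim conjE)
  fix P assume P: "perturbation R P" and nz: "\<exists>x\<in>cball 0 R. P x \<noteq> 0"
  obtain G K where G: "continuous_on {0..R} h" "continuous_on {0<..<R} G"
    "\<And>r. r \<in> {0<..<R} \<Longrightarrow> (h has_real_derivative G r) (at r)"
    "\<And>r. r \<in> {0<..<R} \<Longrightarrow> \<bar>G r\<bar> \<le> K / r"
    by (rule radial_minimizer_regular[OF min R]) blast
  obtain U where U: "open U" "cball 0 R \<subseteq> U" "\<And>k. C_k_on k U P"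
    and P_sym: "\<And>x. x \<in> cball 0 R \<Longrightarrow> P x \<in> sym_traceless"
    and P0: "\<And>x. x \<in> sphere 0 R \<Longrightarrow> P x = 0"
    using P unfolding perturbation_def by blast
  define P' where "P' = (\<lambda>x. frechet_derivative P (at x))"
  have "C_k_on (Suc 0) U P" by (rule U(3))
  then have dP: "\<And>x. x \<in> U \<Longrightarrow> P differentiable (at x)"
    and cP: "\<And>v. v \<in> Basis \<Longrightarrow> continuous_on U (\<lambda>x. P' x v)"
    by (simp_all add: P'_def)
  interpret hedgehog_perturbation t R h G K P P'
  proof
    show "(P has_derivative P' x) (at x)" if "x \<in> cball 0 R" for x
      unfolding P'_def using dP U(2) that by (auto simp: frechet_derivative_works[symmetric])
    show "continuous_on (cball 0 R) (\<lambda>x. P' x v)" if "v \<in> Basis" for v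
      using cP[OF that] U(2) by (rule continuous_on_subset)
  qed (use R G P_sym in auto)
  show "second_variation_pos t R (hedgehog h) P"
    unfolding second_variation_pos_iff
    by (rule energy_coeff_2_pos[OF _ radius_condition_imp[OF t small] P0 nz]) (use t in simp)
qed

lemma dimensional_radius_condition:
  assumes "t > 0" "\<xi> > 0" "R = sqrt t * R_real / \<xi>"
  shows "R\<^sup>2 < 1 / 4 * c \<longleftrightarrow> R_real\<^sup>2 < \<xi>\<^sup>2 / (4 * t) * c"
proof -
  have R2: "R\<^sup>2 = t / \<xi>\<^sup>2 * R_real\<^sup>2"
    using assms by (simp add: power_divide power_mult_distrib)
  show ?thesis
    unfolding R2 using assms(1,2) by (simp add: field_simps)
qed

theorem proposition6p1:
  fixes t R :: real
  assumes "t > 1" and "R > 0"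
  shows "(R\<^sup>2 < 1 / 4 * (1 / (1 + 4 * sqrt 6 * h_plus t / t)) \<longrightarrow>
            (\<forall>h. radial_minimizer t R h \<longrightarrow> LG_stable t R (hedgehog h))) \<and>
         (\<forall>a b c L R_real \<xi> :: real.
            a\<^sup>2 > 0 \<and> b\<^sup>2 > 0 \<and> c\<^sup>2 > 0 \<and> L > 0 \<and>
            t = reduced_temperature a b c \<and> \<xi> = correlation_length b c L \<and>
            R = sqrt t * R_real / \<xi> \<longrightarrow>
            (R\<^sup>2 < 1 / 4 * (1 / (1 + 4 * sqrt 6 * h_plus t / t)) \<longleftrightarrow>
             R_real\<^sup>2 < \<xi>\<^sup>2 / (4 * t) * (1 / (1 + 4 * sqrt 6 * h_plus t / t))))"
proof (intro conjI impI allI)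
  show "LG_stable t R (hedgehog h)"
    if "R\<^sup>2 < 1 / 4 * (1 / (1 + 4 * sqrt 6 * h_plus t / t))" "radial_minimizer t R h" for h
    using LG_stable_hedgehog[OF assms that] .
next
  fix a b c L R_real \<xi> :: real
  assume *: "a\<^sup>2 > 0 \<and> b\<^sup>2 > 0 \<and> c\<^sup>2 > 0 \<and> L > 0 \<and>
    t = reduced_temperature a b c \<and> \<xi> = correlation_length b c L \<and> R = sqrt t * R_real / \<xi>"
  then have "\<xi> > 0" by (simp add: correlation_length_def)
  then show "R\<^sup>2 < 1 / 4 * (1 / (1 + 4 * sqrt 6 * h_plus t / t)) \<longleftrightarrow>
      R_real\<^sup>2 < \<xi>\<^sup>2 / (4 * t) * (1 / (1 + 4 * sqrt 6 * h_plus t / t))"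
    using * assms(1) by (intro dimensional_radius_condition) auto
qed

end
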